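(* Let $a,b>0$. The $F_{a,b}$ transform induces a well-defined isometry $$\mathrm{Imm}(I,\mathbb{C})/\{\mathrm{Tra},\mathrm{Rot}\}\to C^\infty(I,\mathbb{C}^\ast)/\mathrm{Rot},\qquad [c]\mapsto [F_{a,b}(c)],$$ with respect to the Riemannian metrics on the quotients induced by $g^{a,b}$ and $g^{L^2}$, respectively.
   Context: $I=[0,1]$, $\mathbb{C}^\ast=\mathbb{C}\setminus\{0\}$, and $\mathbb{R}^2$ is identified with $\mathbb{C}$. $\mathrm{Imm}(I,\mathbb{C})=\{c\in C^\infty(I,\mathbb{C}) : c'(t)\neq 0 \text{ for all } t\in I\}$, and $\mathrm{Imm}(I,\mathbb{C})/\mathrm{Tra}$ is identified with the set of $c\in\mathrm{Imm}(I,\mathbb{C})$ with $c(0)=0$. The rotation group $\mathrm{Rot}=\mathrm{SO}(2)\cong S^1$ acts on $\mathrm{Imm}(I,\mathbb{C})/\mathrm{Tra}$ and on $C^\infty(I,\mathbb{C}^\ast)$ by pointwise multiplication by $\exp(i\psi)$; brackets $[\cdot]$ denote $\mathrm{SO}(2)$-orbits. An isometry is a bijection between the quotient (infinite-dimensional) Riemannian manifolds preserving the induced metrics. Elastic metric: for $c\in\mathrm{Imm}(I,\mathbb{C})$ let $T=c'/|c'|$, $N=iT$, $D_s=\frac{1}{|c'(t)|}\frac{d}{dt}$, $\mathrm{d}s=|c'(t)|\,\mathrm{d}t$. Then $$g^{a,b}_c(h,k)=\int_I a^2\langle D_sh,N\rangle\langle D_sk,N\rangle+b^2\langle D_sh,T\rangle\langle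 D_sk,T\rangle\,\mathrm{d}s,$$ where $\langle z,w\rangle=\mathrm{Re}(z\overline{w})$. $L^2$ metric: $g^{L^2}_q(w,z)=\mathrm{Re}\int_I w\overline{z}\,\mathrm{d}t$. Both metrics are $\mathrm{SO}(2)$-invariant and so induce metrics on the quotients. The transform: for $c\in\mathrm{Imm}(I,\mathbb{C})/\mathrm{Tra}$ write $c'=r\exp(i\theta)$ with $r=|c'|$ and $\theta:I\to\mathbb{R}$ continuous (unique up to an additive constant in $2\pi\mathbb{Z}$). Then $F_{a,b}(c)=2b\,|c'|^{1/2}\left(\frac{c'}{|c'|}\right)^{\frac{a}{2b}}$ means $2b\,r^{1/2}\exp\left(i\theta\frac{a}{2b}\right)$. This is in general multivalued because of the choice of $\theta$; its set of values is $\{q\exp(i\frac{a}{b}k\pi): k\in\mathbb{Z}\}$, where $q$ is any one value. In the induced map, $[F_{a,b}(c)]$ denotes the orbit of any one of these values. *)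

theory Defs
  imports "HOL-Analysis.Analysis"
begin

section \<open>Smooth functions on the unit interval\<close>

abbreviation unit_ivl :: "real set" where
  "unit_ivl \<equiv> {0..1}"

text \<open>The derivative is one-sided at the two end points. A function on the unit interval is an
  extensional function (arbitrary but fixed outside the interval), so that equality of functions
  on the interval is equality in HOL.\<close>

definition Dt :: "(real \<Rightarrow> complex) \<Rightarrow> real \<Rightarrow> complex" where
  "Dt f t = vector_derivative f (at t within unit_ivl)"

definition Cinf :: "(real \<Rightarrow> complex) set" where
  "Cinf = {f \<in> extensional unit_ivl.
             \<forall>m. \<forall>t\<in>unit_ivl. (Dt ^^ m) f differentiable (at t within unit_ivl)}"

text \<open>Immersions modulo translations, represented by the immersions starting at \<open>0\<close>.\<close>

definition Imm0 :: "(real \<Rightarrow> complex) set" where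
  "Imm0 = {c \<in> Cinf. (\<forall>t\<in>unit_ivl. Dt c t \<noteq> 0) \<and> c 0 = 0}"

definition Cinf_star :: "(real \<Rightarrow> complex) set" where
  "Cinf_star = {q \<in> Cinf. \<forall>t\<in>unit_ivl. q t \<noteq> 0}"

section \<open>The Riemannian metrics\<close>

definition unit_tangent :: "(real \<Rightarrow> complex) \<Rightarrow> real \<Rightarrow> complex" where
  "unit_tangent c t = Dt c t / norm (Dt c t)"

definition unit_normal :: "(real \<Rightarrow> complex) \<Rightarrow> real \<Rightarrow> complex" where
  "unit_normal c t = \<i> * unit_tangent c t"

definition Ds :: "(real \<Rightarrow> complex) \<Rightarrow> (real \<Rightarrow> complex) \<Rightarrow> real \<Rightarrow> complex" where
  "Ds c h t = Dt h t / norm (Dt c t)"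

definition elastic_metric ::
  "real \<Rightarrow> real \<Rightarrow> (real \<Rightarrow> complex) \<Rightarrow> (real \<Rightarrow> complex) \<Rightarrow> (real \<Rightarrow> complex) \<Rightarrow> real" where
  "elastic_metric a b c h k = integral unit_ivl (\<lambda>t.
     (a\<^sup>2 * inner (Ds c h t) (unit_normal c t) * inner (Ds c k t) (unit_normal c t)
      + b\<^sup>2 * inner (Ds c h t) (unit_tangent c t) * inner (Ds c k t) (unit_tangent c t))
     * norm (Dt c t))"

definition L2_metric ::
  "(real \<Rightarrow> complex) \<Rightarrow> (real \<Rightarrow> complex) \<Rightarrow> (real \<Rightarrow> complex) \<Rightarrow> real" where
  "L2_metric q w z = Re (integral unit_ivl (\<lambda>t. w t * cnj (z t)))"

section \<open>Smooth curves in the Frechet space of smooth functions\<close>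

text \<open>Differentiability of a curve \<open>\<gamma>\<close> of smooth functions is taken in the Frechet topology:
  the difference quotients converge uniformly together with all their derivatives.\<close>

definition has_Cinf_derivative ::
  "(real \<Rightarrow> real \<Rightarrow> complex) \<Rightarrow> (real \<Rightarrow> complex) \<Rightarrow> real \<Rightarrow> bool" where
  "has_Cinf_derivative \<gamma> v s \<longleftrightarrow> v \<in> Cinf \<and>
     (\<forall>m. uniform_limit unit_ivl
        (\<lambda>u. (Dt ^^ m) (\<lambda>t. (\<gamma> u t - \<gamma> s t) /\<^sub>R (u - s))) ((Dt ^^ m) v) (at s))"

definition smooth_curve :: "(real \<Rightarrow> complex) set \<Rightarrow> (real \<Rightarrow> real \<Rightarrow> complex) \<Rightarrow> bool" where
  "smooth_curve M \<gamma> \<longleftrightarrow> (\<forall>s. \<gamma> s \<in> M) \<and>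
     (\<exists>\<delta>. \<delta> 0 = \<gamma> \<and> (\<forall>n s. has_Cinf_derivative (\<delta> n) (\<delta> (Suc n) s) s))"

section \<open>The quotient by rotations\<close>

definition rot :: "real \<Rightarrow> (real \<Rightarrow> complex) \<Rightarrow> real \<Rightarrow> complex" where
  "rot \<psi> f = (\<lambda>t\<in>unit_ivl. exp (\<i> * \<psi>) * f t)"

definition rot_orbit :: "(real \<Rightarrow> complex) \<Rightarrow> (real \<Rightarrow> complex) set" where
  "rot_orbit f = range (\<lambda>\<psi>. rot \<psi> f)"

definition rot_quotient :: "(real \<Rightarrow> complex) set \<Rightarrow> (real \<Rightarrow> complex) set set" where
  "rot_quotient M = rot_orbit ` M"

text \<open>The orbit of \<open>f\<close> has tangent space spanned by \<open>\<i> f\<close> at \<open>f\<close>. The metric induced by \<open>g\<close> on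
  the quotient pairs the classes of \<open>h\<close> and \<open>k\<close> modulo \<open>\<i> f\<close> by applying \<open>g\<close> to their
  components orthogonal to \<open>\<i> f\<close>, so that the projection is a Riemannian submersion.\<close>

definition rot_gen :: "(real \<Rightarrow> complex) \<Rightarrow> real \<Rightarrow> complex" where
  "rot_gen f = (\<lambda>t\<in>unit_ivl. \<i> * f t)"

definition horizontal_part ::
  "((real \<Rightarrow> complex) \<Rightarrow> (real \<Rightarrow> complex) \<Rightarrow> (real \<Rightarrow> complex) \<Rightarrow> real)
   \<Rightarrow> (real \<Rightarrow> complex) \<Rightarrow> (real \<Rightarrow> complex) \<Rightarrow> real \<Rightarrow> complex" where
  "horizontal_part g f h =
     (\<lambda>t\<in>unit_ivl. h t - (g f h (rot_gen f) / g f (rot_gen f) (rot_gen f)) *\<^sub>R rot_gen f t)"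

definition quotient_metric ::
  "((real \<Rightarrow> complex) \<Rightarrow> (real \<Rightarrow> complex) \<Rightarrow> (real \<Rightarrow> complex) \<Rightarrow> real)
   \<Rightarrow> (real \<Rightarrow> complex) \<Rightarrow> (real \<Rightarrow> complex) \<Rightarrow> (real \<Rightarrow> complex) \<Rightarrow> real" where
  "quotient_metric g f h k = g f (horizontal_part g f h) (horizontal_part g f k)"

text \<open>The action being free, the projection is a principal circle bundle, and the smooth curves in
  the quotient are the projections of smooth curves. A map is smooth if it maps smooth curves to
  smooth curves (for Frechet manifolds this is equivalent to the usual notion).\<close>

definition smooth_quotient_curve ::
  "(real \<Rightarrow> complex) set \<Rightarrow> (real \<Rightarrow> (real \<Rightarrow> complex) set) \<Rightarrow> bool" where
  "smooth_quotient_curve M \<Gamma> \<longleftrightarrow> (\<exists>\<gamma>. smooth_curve M \<gamma> \<and> \<Gamma> = (\<lambda>s. rot_orbit (\<gamma> s)))"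

definition smooth_quotient_map ::
  "(real \<Rightarrow> complex) set \<Rightarrow> (real \<Rightarrow> complex) set
   \<Rightarrow> ((real \<Rightarrow> complex) set \<Rightarrow> (real \<Rightarrow> complex) set) \<Rightarrow> bool" where
  "smooth_quotient_map M N \<Phi> \<longleftrightarrow>
     (\<forall>\<Gamma>. smooth_quotient_curve M \<Gamma> \<longrightarrow> smooth_quotient_curve N (\<Phi> \<circ> \<Gamma>))"

text \<open>The differential of \<open>\<Phi>\<close> maps the class of \<open>h\<close>, represented at \<open>c\<close>, to the class of \<open>w\<close>,
  represented at \<open>q\<close>. As usual it is computed on velocities of curves; every tangent vector of
  \<open>M\<close> at \<open>c\<close> is such a velocity because \<open>M\<close> is open in a Frechet space.\<close>

definition quotient_differential ::
  "(real \<Rightarrow> complex) set \<Rightarrow> (real \<Rightarrow> complex) set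
   \<Rightarrow> ((real \<Rightarrow> complex) set \<Rightarrow> (real \<Rightarrow> complex) set)
   \<Rightarrow> (real \<Rightarrow> complex) \<Rightarrow> (real \<Rightarrow> complex) \<Rightarrow> (real \<Rightarrow> complex) \<Rightarrow> (real \<Rightarrow> complex) \<Rightarrow> bool" where
  "quotient_differential M N \<Phi> c h q w \<longleftrightarrow>
     (\<exists>\<gamma> \<eta>. smooth_curve M \<gamma> \<and> \<gamma> 0 = c \<and> has_Cinf_derivative \<gamma> h 0 \<and>
            smooth_curve N \<eta> \<and> \<eta> 0 = q \<and> has_Cinf_derivative \<eta> w 0 \<and>
            (\<forall>s. \<Phi> (rot_orbit (\<gamma> s)) = rot_orbit (\<eta> s)))"

definition quotient_isometry ::
  "(real \<Rightarrow> complex) set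
   \<Rightarrow> ((real \<Rightarrow> complex) \<Rightarrow> (real \<Rightarrow> complex) \<Rightarrow> (real \<Rightarrow> complex) \<Rightarrow> real)
   \<Rightarrow> (real \<Rightarrow> complex) set
   \<Rightarrow> ((real \<Rightarrow> complex) \<Rightarrow> (real \<Rightarrow> complex) \<Rightarrow> (real \<Rightarrow> complex) \<Rightarrow> real)
   \<Rightarrow> ((real \<Rightarrow> complex) set \<Rightarrow> (real \<Rightarrow> complex) set) \<Rightarrow> bool" where
  "quotient_isometry M g N g' \<Phi> \<longleftrightarrow>
     bij_betw \<Phi> (rot_quotient M) (rot_quotient N) \<and>
     smooth_quotient_map M N \<Phi> \<and>
     smooth_quotient_map N M (inv_into (rot_quotient M) \<Phi>) \<and>
     (\<forall>c h k q w z. quotient_differential M N \<Phi> c h q w \<and> quotient_differential M N \<Phi> c k q z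
        \<longrightarrow> quotient_metric g' q w z = quotient_metric g c h k)"

section \<open>The transform\<close>

text \<open>The set of values of the multivalued transform, one for each continuous choice of the
  angle.\<close>

definition F_values :: "real \<Rightarrow> real \<Rightarrow> (real \<Rightarrow> complex) \<Rightarrow> (real \<Rightarrow> complex) set" where
  "F_values a b c =
     {(\<lambda>t\<in>unit_ivl. 2 * b * sqrt (norm (Dt c t)) * exp (\<i> * \<theta> t * (a / (2 * b)))) |\<theta> :: real \<Rightarrow> real.
        continuous_on unit_ivl \<theta> \<and>
        (\<forall>t\<in>unit_ivl. Dt c t = norm (Dt c t) * exp (\<i> * \<theta> t))}"

end

theory Submission imports Defs begin

text \<open>
  In logarithmic coordinates the transform is an affine map. If \<open>c' = exp \<circ> l\<close> for a continuous complex
  function \<open>l\<close>, then the value of the transform for the angle \<open>Im \<circ> l\<close> is \<open>exp \<circ> L \<circ> l\<close>, where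
  \<open>L z = ln (2 b) + Re z / 2 + \<i> (a / (2 b)) Im z\<close> is an invertible real affine map of the plane
  (\<open>log_transform\<close>). Rotating \<open>c\<close> means adding an imaginary constant to \<open>l\<close>, and \<open>L\<close> and its inverse
  carry such constants to such constants. As two continuous logarithms of functions that differ by a
  rotation differ by one imaginary constant (\<open>logarithms_of_rotated\<close>), the induced map of orbits is
  well defined (\<open>F_values_same_orbit\<close>) and injective (\<open>F_values_orbit_injective\<close>). It is
  surjective, because every nowhere vanishing \<open>q\<close> has a logarithm, to which the inverse of \<open>L\<close> and
  one integration can be applied.

  Smoothness of the map and of its inverse, for curves of curves, needs the same construction with
  a parameter. A smooth curve in the Frechet space of smooth functions is the same thing as a function
  on the strip \<open>\<real> \<times> [0,1]\<close> all of whose iterated partial derivatives exist and are continuous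
  (\<open>smooth_curve_imp_strip\<close>, \<open>strip_imp_smooth_curve\<close>). On the strip the operations that
  occur - affine maps, \<open>exp\<close>, continuous logarithms, integration in the second variable -
  preserve smoothness by short inductions, and logarithms exist because the strip is contractible.
  Constant curves are a special case, so that the pointwise facts follow from the facts on curves.

  For the metrics, write a tangent vector \<open>h\<close> at \<open>c\<close> as \<open>h' = c' x\<close>, where \<open>x\<close> is the velocity of the
  logarithm \<open>l\<close>. Differentiating \<open>L\<close>, the corresponding vector at \<open>q\<close> is \<open>q (L\<^sub>0 x + \<i> \<beta>)\<close> with \<open>L\<^sub>0\<close>
  the linear part of \<open>L\<close> and a real \<open>\<beta>\<close> that depends on the chosen lift
  (\<open>transformed_velocity\<close>). The elastic metric is the integral of
  \<open>\<bar>c'\<bar> (a\<^sup>2 Im x Im y + b\<^sup>2 Re x Re y)\<close>, and since \<open>\<bar>q\<bar>\<^sup>2 = 4 b\<^sup>2 \<bar>c'\<bar>\<close> this is the integral of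
  \<open>\<bar>q\<bar>\<^sup>2 (L\<^sub>0 x) \<bullet> (L\<^sub>0 y)\<close>. On both sides, projecting to the horizontal space subtracts from \<open>Im x\<close> its
  mean with weight \<open>\<bar>c'\<bar>\<close>, which also removes \<open>\<beta>\<close>
  (\<open>elastic_quotient_metric\<close>, \<open>L2_quotient_metric\<close>).
\<close>

section \<open>Smooth functions on the interval\<close>

lemma Dt_eqI:
  assumes "t \<in> unit_ivl" "(f has_vector_derivative d) (at t within unit_ivl)"
  shows "Dt f t = d"
  using vector_derivative_within_closed_interval[of 0 1 t f d] assms by (simp add: Dt_def)

lemma Dt_cong:
  assumes "\<And>t. t \<in> unit_ivl \<Longrightarrow> f t = g t" "t \<in> unit_ivl"
  shows "Dt f t = Dt g t"
proof -
  have "(f has_vector_derivative d) (at t within unit_ivl) \<longleftrightarrow>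
        (g has_vector_derivative d) (at t within unit_ivl)" for d
    using assms by (intro has_vector_derivative_cong_ev) (auto simp: eventually_nhds)
  then show ?thesis by (simp add: Dt_def vector_derivative_def)
qed

lemma Dt_pow_cong:
  assumes "\<And>t. t \<in> unit_ivl \<Longrightarrow> f t = g t" "t \<in> unit_ivl"
  shows "(Dt ^^ m) f t = (Dt ^^ m) g t"
  using assms(2)
proof (induction m arbitrary: t)
  case (Suc m)
  then show ?case using Dt_cong[of "(Dt ^^ m) f" "(Dt ^^ m) g" t] by simp
qed (use assms in auto)

lemma Cinf_Dt_pow_vderiv:
  assumes "f \<in> Cinf" "t \<in> unit_ivl"
  shows "((Dt ^^ m) f has_vector_derivative (Dt ^^ Suc m) f t) (at t within unit_ivl)"
proof -
  have "(Dt ^^ m) f differentiable (at t within unit_ivl)"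
    using assms by (auto simp: Cinf_def)
  then show ?thesis by (simp add: vector_derivative_works Dt_def)
qed

lemma Cinf_vderiv:
  assumes "f \<in> Cinf" "t \<in> unit_ivl"
  shows "(f has_vector_derivative Dt f t) (at t within unit_ivl)"
  using Cinf_Dt_pow_vderiv[OF assms, of 0] by simp

lemma Cinf_Dt_pow_continuous:
  assumes "f \<in> Cinf"
  shows "continuous_on unit_ivl ((Dt ^^ m) f)"
  by (meson Cinf_Dt_pow_vderiv[OF assms] continuous_on_vector_derivative)

lemma Cinf_Dt_continuous:
  assumes "f \<in> Cinf"
  shows "continuous_on unit_ivl (Dt f)"
  using Cinf_Dt_pow_continuous[OF assms, of 1] by simp

text \<open>Difference quotients of a curve in \<open>Cinf\<close> have this form.\<close>

lemma Dt_pow_linear: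
  assumes "f \<in> Cinf" "g \<in> Cinf" "t \<in> unit_ivl"
  shows "(Dt ^^ m) (\<lambda>t. x *\<^sub>R (f t - g t)) t = x *\<^sub>R ((Dt ^^ m) f t - (Dt ^^ m) g t)"
  using assms(3)
proof (induction m arbitrary: t)
  case (Suc m)
  have "(Dt ^^ Suc m) (\<lambda>t. x *\<^sub>R (f t - g t)) t
      = Dt (\<lambda>t. x *\<^sub>R ((Dt ^^ m) f t - (Dt ^^ m) g t)) t"
    using Dt_cong[OF Suc.IH Suc.prems] by simp
  also have "\<dots> = x *\<^sub>R ((Dt ^^ Suc m) f t - (Dt ^^ Suc m) g t)"
    using Suc.prems
    by (intro Dt_eqI) (auto intro!: derivative_eq_intros
        Cinf_Dt_pow_vderiv[OF assms(1), simplified] Cinf_Dt_pow_vderiv[OF assms(2), simplified])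
  finally show ?case .
qed simp

lemma Cinf_if_Dt_pow_differentiable:
  assumes "\<And>m t. t \<in> unit_ivl \<Longrightarrow> (Dt ^^ m) f differentiable (at t within unit_ivl)"
  shows "restrict f unit_ivl \<in> Cinf"
proof -
  have "(Dt ^^ m) (restrict f unit_ivl) differentiable (at t within unit_ivl)"
    if t: "t \<in> unit_ivl" for m t
  proof (rule differentiable_transform_within[OF assms[OF t, of m] zero_less_one t])
    show "(Dt ^^ m) f t' = (Dt ^^ m) (restrict f unit_ivl) t'" if "t' \<in> unit_ivl" for t'
      by (rule Dt_pow_cong) (use that in auto)
  qed
  then show ?thesis by (auto simp: Cinf_def)
qed

section \<open>Differentiability on the strip\<close>

text \<open>Differentiability is required on \<open>\<real> \<times> [0,1]\<close> only; the derivative in the second variable is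
  one-sided at the two ends, as in \<open>Dt\<close>.\<close>

definition strip_partials ::
  "(real \<Rightarrow> real \<Rightarrow> complex) \<Rightarrow> (real \<Rightarrow> real \<Rightarrow> complex) \<Rightarrow> (real \<Rightarrow> real \<Rightarrow> complex) \<Rightarrow> bool" where
  "strip_partials f fs ft \<longleftrightarrow> (\<forall>s. \<forall>t\<in>unit_ivl.
     ((\<lambda>u. f u t) has_vector_derivative fs s t) (at s) \<and>
     (f s has_vector_derivative ft s t) (at t within unit_ivl))"

definition strip_continuous :: "(real \<Rightarrow> real \<Rightarrow> complex) \<Rightarrow> bool" where
  "strip_continuous f \<longleftrightarrow> continuous_on (UNIV \<times> unit_ivl) (\<lambda>p. f (fst p) (snd p))"

text \<open>The functions of class \<open>C\<^sup>k\<close> on the strip. The recursion passes to a pair of partial derivatives, so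
  that closure under an operation is proved by induction on \<open>k\<close> from the formula for its first
  partial derivatives. No order of differentiation is singled out; that mixed partial derivatives
  agree is a theorem (\<open>mixed_partials_commute\<close>).\<close>

primrec C_strip :: "nat \<Rightarrow> (real \<Rightarrow> real \<Rightarrow> complex) \<Rightarrow> bool" where
  "C_strip 0 f \<longleftrightarrow> strip_continuous f"
| "C_strip (Suc k) f \<longleftrightarrow> strip_continuous f \<and>
     (\<exists>fs ft. C_strip k fs \<and> C_strip k ft \<and> strip_partials f fs ft)"

definition smooth_strip :: "(real \<Rightarrow> real \<Rightarrow> complex) \<Rightarrow> bool" where
  "smooth_strip f \<longleftrightarrow> (\<forall>k. C_strip k f)"

definition Dx :: "(real \<Rightarrow> real \<Rightarrow> complex) \<Rightarrow> real \<Rightarrow> real \<Rightarrow> complex" where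
  "Dx f s t = vector_derivative (\<lambda>u. f u t) (at s)"

lemma C_strip_SucI:
  assumes "strip_continuous f" "C_strip k fs" "C_strip k ft" "strip_partials f fs ft"
  shows "C_strip (Suc k) f"
  using assms by auto

lemma C_strip_SucE:
  assumes "C_strip (Suc k) f"
  obtains fs ft where "C_strip k fs" "C_strip k ft" "strip_partials f fs ft"
  using assms by auto

lemma strip_partials_vderiv:
  assumes "strip_partials f fs ft" "t \<in> unit_ivl"
  shows "((\<lambda>u. f u t) has_vector_derivative fs s t) (at s)"
    "(f s has_vector_derivative ft s t) (at t within unit_ivl)"
  using assms by (auto simp: strip_partials_def)

lemma strip_partials_cong:
  assumes f: "strip_partials f fs ft" and g: "\<And>s t. t \<in> unit_ivl \<Longrightarrow> g s t = f s t"
  shows "strip_partials g fs ft"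
  unfolding strip_partials_def
proof (intro allI ballI conjI)
  fix s t :: real assume t: "t \<in> unit_ivl"
  show "((\<lambda>u. g u t) has_vector_derivative fs s t) (at s)"
    using strip_partials_vderiv(1)[OF f t, of s] g[OF t] by simp
  show "(g s has_vector_derivative ft s t) (at t within unit_ivl)"
    by (rule has_vector_derivative_transform[OF t _ strip_partials_vderiv(2)[OF f t]]) (simp add: g)
qed

lemma strip_continuous_cong:
  assumes "strip_continuous f" "\<And>s t. t \<in> unit_ivl \<Longrightarrow> g s t = f s t"
  shows "strip_continuous g"
  using assms unfolding strip_continuous_def
  by (elim continuous_on_eq) auto

lemma C_strip_cong:
  assumes "C_strip k f" "\<And>s t. t \<in> unit_ivl \<Longrightarrow> g s t = f s t"
  shows "C_strip k g"
proof (cases k)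
  case 0
  then show ?thesis using assms strip_continuous_cong[of f g] by simp
next
  case (Suc j)
  then obtain fs ft where F: "C_strip j fs" "C_strip j ft" "strip_partials f fs ft"
    using assms(1) by auto
  have "strip_continuous g" using assms Suc strip_continuous_cong[of f g] by auto
  then show ?thesis
    using C_strip_SucI[OF _ F(1,2) strip_partials_cong[OF F(3) assms(2)]] Suc by simp
qed

lemma C_strip_continuous: "C_strip k f \<Longrightarrow> strip_continuous f"
  by (cases k) auto

lemma C_strip_Suc_imp: "C_strip (Suc k) f \<Longrightarrow> C_strip k f"
proof (induction k arbitrary: f)
  case (Suc k)
  obtain fs ft where F: "C_strip (Suc k) fs" "C_strip (Suc k) ft" "strip_partials f fs ft"
    using Suc.prems by (rule C_strip_SucE)
  show ?case
    by (rule C_strip_SucI[OF C_strip_continuous[OF Suc.prems] Suc.IH[OF F(1)] Suc.IH[OF F(2)] F(3)])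
qed simp

lemma strip_continuous_comp:
  assumes "strip_continuous f" "continuous_on A x" "continuous_on A y" "y ` A \<subseteq> unit_ivl"
  shows "continuous_on A (\<lambda>z. f (x z) (y z))"
  using continuous_on_compose2[OF assms(1)[unfolded strip_continuous_def],
      where f = "\<lambda>z. (x z, y z)" and s = A] assms
  by (auto intro!: continuous_intros)

lemma strip_partials_unique:
  assumes "strip_partials f fs ft" "t \<in> unit_ivl"
  shows "Dx f s t = fs s t" "Dt (f s) t = ft s t"
  using strip_partials_vderiv[OF assms] assms(2)
  by (auto simp: Dx_def vector_derivative_at Dt_eqI)

text \<open>The partial derivatives in \<open>C_strip\<close> are chosen anew for each \<open>k\<close>; being unique on the strip, they
  all agree there with the two canonical ones.\<close>

lemma smooth_strip_partials:
  assumes "smooth_strip f"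
  shows "strip_partials f (Dx f) (\<lambda>s. Dt (f s))" "smooth_strip (Dx f)" "smooth_strip (\<lambda>s. Dt (f s))"
proof -
  have "\<exists>fs ft. C_strip k fs \<and> C_strip k ft \<and> strip_partials f fs ft" for k
    using assms C_strip.simps(2)[of k f] unfolding smooth_strip_def by blast
  then obtain fs ft where F: "\<And>k. C_strip k (fs k)" "\<And>k. C_strip k (ft k)"
      "\<And>k. strip_partials f (fs k) (ft k)" by metis
  note eq = strip_partials_unique[OF F(3)]
  show "strip_partials f (Dx f) (\<lambda>s. Dt (f s))"
    using F(3)[of 0] eq[of _ _ 0] by (simp add: strip_partials_def)
  show "smooth_strip (Dx f)" "smooth_strip (\<lambda>s. Dt (f s))"
    unfolding smooth_strip_def using C_strip_cong[OF F(1) eq(1)] C_strip_cong[OF F(2) eq(2)] by auto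
qed

text \<open>When all mixed partial derivatives are given at once as a doubly indexed family, every member is
  smooth.\<close>

lemma smooth_stripI_family:
  assumes "\<And>n m. strip_continuous (F n m)"
    and "\<And>n m. strip_partials (F n m) (F (Suc n) m) (F n (Suc m))"
  shows "smooth_strip (F n m)"
proof -
  have "C_strip k (F n m)" for k
  proof (induction k arbitrary: n m)
    case (Suc k)
    show ?case by (rule C_strip_SucI[OF assms(1) Suc.IH Suc.IH assms(2)])
  qed (simp add: assms)
  then show ?thesis by (simp add: smooth_strip_def)
qed

lemma C_strip_const: "C_strip k (\<lambda>s t. z)"
proof -
  have "smooth_strip (\<lambda>s t. if n = 0 \<and> m = 0 then z else 0)" for n m :: nat
    by (rule smooth_stripI_family[where F = "\<lambda>n m s t. if n = 0 \<and> m = 0 then z else 0"])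
      (auto simp: strip_continuous_def strip_partials_def)
  from this[of 0 0] show ?thesis by (simp add: smooth_strip_def)
qed

lemma strip_partials_linear:
  assumes "bounded_linear L" "strip_partials f fs ft"
  shows "strip_partials (\<lambda>s t. L (f s t)) (\<lambda>s t. L (fs s t)) (\<lambda>s t. L (ft s t))"
  using strip_partials_vderiv[OF assms(2)] assms(1)
  by (simp add: strip_partials_def bounded_linear.has_vector_derivative[OF assms(1)])

lemma C_strip_linear:
  assumes "bounded_linear L"
  shows "C_strip k f \<Longrightarrow> C_strip k (\<lambda>s t. L (f s t))"
proof (induction k arbitrary: f)
  case 0
  then show ?case
    by (simp add: strip_continuous_def bounded_linear.continuous_on[OF assms])
next
  case (Suc k)
  have c: "strip_continuous (\<lambda>s t. L (f s t))"
    using C_strip_continuous[OF Suc.prems]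
    by (simp add: strip_continuous_def bounded_linear.continuous_on[OF assms])
  obtain fs ft where F: "C_strip k fs" "C_strip k ft" "strip_partials f fs ft"
    using Suc.prems by (rule C_strip_SucE)
  show ?case
    by (rule C_strip_SucI[OF c Suc.IH[OF F(1)] Suc.IH[OF F(2)] strip_partials_linear[OF assms F(3)]])
qed

lemma C_strip_add:
  "C_strip k f \<Longrightarrow> C_strip k g \<Longrightarrow> C_strip k (\<lambda>s t. f s t + g s t)"
proof (induction k arbitrary: f g)
  case 0
  then show ?case by (auto simp: strip_continuous_def intro!: continuous_intros)
next
  case (Suc k)
  have c: "strip_continuous (\<lambda>s t. f s t + g s t)"
    using Suc.prems[THEN C_strip_continuous]
    by (auto simp: strip_continuous_def intro!: continuous_intros)
  obtain fs ft where f: "C_strip k fs" "C_strip k ft" "strip_partials f fs ft"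
    using Suc.prems(1) by (rule C_strip_SucE)
  obtain gs gt where g: "C_strip k gs" "C_strip k gt" "strip_partials g gs gt"
    using Suc.prems(2) by (rule C_strip_SucE)
  have
    "strip_partials (\<lambda>s t. f s t + g s t) (\<lambda>s t. fs s t + gs s t) (\<lambda>s t. ft s t + gt s t)"
    using f(3) g(3) by (auto simp: strip_partials_def intro!: has_vector_derivative_add)
  then show ?case
    by (rule C_strip_SucI[OF c Suc.IH[OF f(1) g(1)] Suc.IH[OF f(2) g(2)]])
qed

lemma C_strip_mult:
  "C_strip k f \<Longrightarrow> C_strip k g \<Longrightarrow> C_strip k (\<lambda>s t. f s t * g s t)"
proof (induction k arbitrary: f g)
  case 0
  then show ?case by (auto simp: strip_continuous_def intro!: continuous_intros)
next
  case (Suc k)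
  have c: "strip_continuous (\<lambda>s t. f s t * g s t)"
    using Suc.prems[THEN C_strip_continuous]
    by (auto simp: strip_continuous_def intro!: continuous_intros)
  have fg: "C_strip k f" "C_strip k g" using Suc.prems by (blast intro: C_strip_Suc_imp)+
  obtain fs ft where f: "C_strip k fs" "C_strip k ft" "strip_partials f fs ft"
    using Suc.prems(1) by (rule C_strip_SucE)
  obtain gs gt where g: "C_strip k gs" "C_strip k gt" "strip_partials g gs gt"
    using Suc.prems(2) by (rule C_strip_SucE)
  have
    "strip_partials (\<lambda>s t. f s t * g s t) (\<lambda>s t. f s t * gs s t + fs s t * g s t)
       (\<lambda>s t. f s t * gt s t + ft s t * g s t)"
    using f(3) g(3) by (auto simp: strip_partials_def intro!: has_vector_derivative_mult)
  then show ?case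
    by (rule C_strip_SucI[OF c
          C_strip_add[OF Suc.IH[OF fg(1) g(1)] Suc.IH[OF f(1) fg(2)]]
          C_strip_add[OF Suc.IH[OF fg(1) g(2)] Suc.IH[OF f(2) fg(2)]]])
qed

section \<open>Exponentials, logarithms and primitives on the strip\<close>

lemma vderiv_exp:
  assumes "(f has_vector_derivative f') (at x within S)"
  shows "((\<lambda>x. exp (f x :: complex)) has_vector_derivative exp (f x) * f') (at x within S)"
  using field_vector_diff_chain_within[OF assms, of exp "exp (f x)"]
  by (simp add: o_def mult.commute has_field_derivative_at_within)

lemma C_strip_exp: "C_strip k f \<Longrightarrow> C_strip k (\<lambda>s t. exp (f s t))"
proof (induction k)
  case 0
  then show ?case by (auto simp: strip_continuous_def intro!: continuous_intros)
next
  case (Suc k)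
  have c: "strip_continuous (\<lambda>s t. exp (f s t))"
    using C_strip_continuous[OF Suc.prems]
    by (auto simp: strip_continuous_def intro!: continuous_intros)
  have e: "C_strip k (\<lambda>s t. exp (f s t))" using Suc C_strip_Suc_imp by blast
  obtain fs ft where F: "C_strip k fs" "C_strip k ft" "strip_partials f fs ft"
    using Suc.prems by auto
  have "strip_partials (\<lambda>s t. exp (f s t)) (\<lambda>s t. exp (f s t) * fs s t) (\<lambda>s t. exp (f s t) * ft s t)"
    using F(3) by (auto simp: strip_partials_def intro!: vderiv_exp)
  then show ?case
    by (rule C_strip_SucI[OF c C_strip_mult[OF e F(1)] C_strip_mult[OF e F(2)]])
qed

text \<open>Near \<open>x\<close> a continuous logarithm is the principal branch up to a translation,
  \<open>l y = l x + Ln (f y / f x)\<close>, because its imaginary part stays within \<open>\<pi>\<close> of the one at \<open>x\<close>.\<close>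

lemma vderiv_log:
  fixes l f :: "real \<Rightarrow> complex"
  assumes l: "continuous (at x within S) l" and e: "\<And>y. y \<in> S \<Longrightarrow> f y = exp (l y)" and x: "x \<in> S"
    and f: "(f has_vector_derivative f') (at x within S)"
  shows "(l has_vector_derivative f' / f x) (at x within S)"
proof -
  have nz: "f x \<noteq> 0" using e x by simp
  have "\<forall>\<^sub>F y in at x within S. dist (l y) (l x) < pi"
    using l by (intro tendstoD) (auto simp: continuous_within)
  then have ev: "\<forall>\<^sub>F y in nhds x. y \<in> S \<longrightarrow> l y = l x + Ln (f y / f x)"
    unfolding eventually_at_filter
  proof (eventually_elim, intro impI)
    fix y assume d: "y \<noteq> x \<longrightarrow> y \<in> S \<longrightarrow> dist (l y) (l x) < pi" and y: "y \<in> S"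
    have "dist (l y) (l x) < pi" using d y by (cases "y = x") auto
    then have "\<bar>Im (l y - l x)\<bar> < pi"
      using abs_Im_le_cmod[of "l y - l x"] by (simp add: dist_norm)
    moreover have "f y / f x = exp (l y - l x)" using e x y by (simp add: exp_diff)
    ultimately show "l y = l x + Ln (f y / f x)" by (simp add: abs_less_iff)
  qed
  \<comment> \<open>The quotient \<open>f x / f x\<close> is \<open>1\<close>, where the derivative of \<open>Ln\<close> is \<open>1\<close>.\<close>
  have "(Ln has_field_derivative 1) (at (f x / f x) within (\<lambda>y. f y / f x) ` S)"
    using nz by (auto intro!: derivative_eq_intros)
  moreover have "((\<lambda>y. f y / f x) has_vector_derivative f' / f x) (at x within S)"
    using f by (auto intro!: derivative_eq_intros)
  ultimately have "((\<lambda>y. Ln (f y / f x)) has_vector_derivative f' / f x) (at x within S)"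
    using field_vector_diff_chain_within[of "\<lambda>y. f y / f x" "f' / f x" x S Ln 1] by (simp add: o_def)
  then have "((\<lambda>y. l x + Ln (f y / f x)) has_vector_derivative f' / f x) (at x within S)"
    by (auto intro!: derivative_eq_intros)
  then show ?thesis
    using has_vector_derivative_cong_ev[OF ev] nz by simp
qed

lemma strip_continuous_slice: "strip_continuous f \<Longrightarrow> continuous_on unit_ivl (f s)"
  by (rule strip_continuous_comp[where x = "\<lambda>_. s" and y = "\<lambda>t. t", simplified]) auto

text \<open>The partial derivatives of the logarithm are \<open>f\<^sub>s exp (- l)\<close> and \<open>f\<^sub>t exp (- l)\<close>. Hence if \<open>l\<close> is
  of class \<open>C\<^sup>k\<close>, so are they, and \<open>l\<close> is of class \<open>C\<^sup>k\<^sup>+\<^sup>1\<close>.\<close>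

lemma smooth_strip_log:
  assumes f: "smooth_strip f" and l: "strip_continuous l"
    and e: "\<And>s t. t \<in> unit_ivl \<Longrightarrow> f s t = exp (l s t)"
  shows "smooth_strip l"
proof -
  note F = smooth_strip_partials[OF f]
  have P: "strip_partials l (\<lambda>s t. Dx f s t * exp (- l s t)) (\<lambda>s t. Dt (f s) t * exp (- l s t))"
    unfolding strip_partials_def
  proof (intro allI ballI conjI)
    fix s t :: real assume t: "t \<in> unit_ivl"
    have "continuous_on UNIV (\<lambda>u. l u t)"
      by (rule strip_continuous_comp[OF l]) (use t in \<open>auto intro!: continuous_intros\<close>)
    then have "continuous (at s) (\<lambda>u. l u t)" by (simp add: continuous_on_eq_continuous_within)
    from vderiv_log[OF this _ _ strip_partials_vderiv(1)[OF F(1) t]]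
    show "((\<lambda>u. l u t) has_vector_derivative Dx f s t * exp (- l s t)) (at s)"
      by (simp add: e[OF t] exp_minus divide_inverse)
    have "continuous (at t within unit_ivl) (l s)"
      using strip_continuous_slice[OF l] t by (simp add: continuous_on_eq_continuous_within)
    from vderiv_log[OF this _ t strip_partials_vderiv(2)[OF F(1) t]]
    show "(l s has_vector_derivative Dt (f s) t * exp (- l s t)) (at t within unit_ivl)"
      by (simp add: e t e[OF t] exp_minus divide_inverse)
  qed
  have "C_strip k l" for k
  proof (induction k)
    case (Suc k)
    have E: "C_strip k (\<lambda>s t. exp (- l s t))"
      using C_strip_exp[OF C_strip_linear[OF bounded_linear_minus[OF bounded_linear_ident] Suc]] by simp
    show ?case
      by (rule C_strip_SucI[OF l C_strip_mult[OF _ E] C_strip_mult[OF _ E] P])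
        (use F in \<open>auto simp: smooth_strip_def\<close>)
  qed (simp add: l)
  then show ?thesis by (simp add: smooth_strip_def)
qed

text \<open>The strip is convex, hence contractible. This gives the choice of an angle that is continuous in both
  variables at once.\<close>

lemma strip_log_exists:
  assumes "strip_continuous f" "\<And>s t. t \<in> unit_ivl \<Longrightarrow> f s t \<noteq> 0"
  obtains l where "strip_continuous l" "\<And>s t. t \<in> unit_ivl \<Longrightarrow> f s t = exp (l s t)"
proof -
  have "contractible ((UNIV :: real set) \<times> unit_ivl)"
    by (intro convex_imp_contractible convex_Times) auto
  moreover have "f (fst p) (snd p) \<noteq> 0" if "p \<in> UNIV \<times> unit_ivl" for p
    by (rule assms(2)) (use that in auto)
  ultimately obtain g where g: "continuous_on (UNIV \<times> unit_ivl) g"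
      "\<And>p. p \<in> UNIV \<times> unit_ivl \<Longrightarrow> f (fst p) (snd p) = exp (g p)"
    by (rule continuous_logarithm_on_contractible[OF assms(1)[unfolded strip_continuous_def]]) auto
  show ?thesis
    by (rule that[of "\<lambda>s t. g (s, t)"]) (use g in \<open>auto simp: strip_continuous_def dest: g(2)[of "(_, _)", simplified]\<close>)
qed

definition primitive :: "(real \<Rightarrow> real \<Rightarrow> complex) \<Rightarrow> real \<Rightarrow> real \<Rightarrow> complex" where
  "primitive g s t = integral {0..t} (g s)"

lemma primitive_vderiv_t:
  assumes "strip_continuous g" "t \<in> unit_ivl"
  shows "(primitive g s has_vector_derivative g s t) (at t within unit_ivl)"
  using integral_has_vector_derivative[OF strip_continuous_slice[OF assms(1)] assms(2)]
  by (simp add: primitive_def[abs_def])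

lemma primitive_vderiv_s:
  assumes g: "strip_continuous g" and gs: "strip_continuous gs"
    and d: "\<And>s t. t \<in> unit_ivl \<Longrightarrow> ((\<lambda>u. g u t) has_vector_derivative gs s t) (at s)"
    and t: "t \<in> unit_ivl"
  shows "((\<lambda>u. primitive g u t) has_vector_derivative primitive gs s t) (at s)"
proof -
  have "((\<lambda>u. integral (cbox 0 t) (g u)) has_vector_derivative integral (cbox 0 t) (gs s)) (at s within UNIV)"
  proof (rule leibniz_rule_vector_derivative)
    show "g x integrable_on cbox 0 t" for x
      using t by (auto intro!: integrable_continuous_real
          continuous_on_subset[OF strip_continuous_slice[OF g]])
    show "continuous_on (UNIV \<times> cbox 0 t) (\<lambda>(x, y). gs x y)"
      using continuous_on_subset[OF gs[unfolded strip_continuous_def], of "UNIV \<times> cbox 0 t"] t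
      by (force simp: split_beta)
  qed (use d t in auto)
  then show ?thesis by (simp add: primitive_def)
qed

text \<open>The substitution moves the variable end point into the integrand, and joint continuity becomes a case
  of continuity of parameter integrals.\<close>

lemma primitive_rescaled:
  assumes g: "strip_continuous g" and t: "t \<in> unit_ivl"
  shows "primitive g s t = integral unit_ivl (\<lambda>x. t *\<^sub>R g s (x * t))"
proof -
  have "((\<lambda>x. primitive g s (x * t)) has_vector_derivative t *\<^sub>R g s (x * t)) (at x within unit_ivl)"
    if x: "x \<in> unit_ivl" for x
  proof -
    have sub: "(\<lambda>x. x * t) ` unit_ivl \<subseteq> unit_ivl" using t by (auto simp: mult_le_one)
    have "(primitive g s has_vector_derivative g s (x * t)) (at (x * t) within (\<lambda>x. x * t) ` unit_ivl)"
      by (rule has_vector_derivative_within_subset[OF primitive_vderiv_t[OF g] sub]) (use t x in \<open>auto simp: mult_le_one\<close>)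
    moreover have "((\<lambda>x. x * t) has_vector_derivative t) (at x within unit_ivl)"
      by (auto intro!: derivative_eq_intros)
    ultimately show ?thesis
      using vector_diff_chain_within[of "\<lambda>x. x * t" t x unit_ivl "primitive g s"] by (simp add: o_def)
  qed
  then have "((\<lambda>x. t *\<^sub>R g s (x * t)) has_integral primitive g s (1 * t) - primitive g s (0 * t)) unit_ivl"
    by (intro fundamental_theorem_of_calculus) auto
  then have "((\<lambda>x. t *\<^sub>R g s (x * t)) has_integral primitive g s t) unit_ivl"
    by (simp add: primitive_def)
  then show ?thesis by (rule integral_unique[symmetric])
qed

lemma strip_continuous_primitive:
  assumes "strip_continuous g"
  shows "strip_continuous (primitive g)"
proof -
  have "strip_continuous (\<lambda>s t. integral (cbox 0 1) (\<lambda>x. t *\<^sub>R g s (x * t)))"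
    unfolding strip_continuous_def
  proof (rule integral_continuous_on_param)
    show "continuous_on ((UNIV \<times> unit_ivl) \<times> cbox 0 1)
        (\<lambda>(p, x). snd p *\<^sub>R g (fst p) (x * snd p))"
      unfolding split_beta
      by (intro continuous_intros strip_continuous_comp[OF assms]) (auto simp: mult_le_one)
  qed
  then show ?thesis
    by (rule strip_continuous_cong) (simp add: primitive_rescaled[OF assms])
qed

lemma C_strip_primitive: "C_strip k g \<Longrightarrow> C_strip k (primitive g)"
proof (induction k arbitrary: g)
  case 0
  then show ?case by (simp add: strip_continuous_primitive)
next
  case (Suc k)
  note g = C_strip_continuous[OF Suc.prems]
  obtain gs gt where F: "C_strip k gs" "C_strip k gt" "strip_partials g gs gt"
    using Suc.prems by (rule C_strip_SucE)
  have "strip_partials (primitive g) (primitive gs) g"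
    using primitive_vderiv_s[OF g C_strip_continuous[OF F(1)]] strip_partials_vderiv(1)[OF F(3)]
      primitive_vderiv_t[OF g]
    by (simp add: strip_partials_def)
  then show ?case
    by (rule C_strip_SucI[OF strip_continuous_primitive[OF g] Suc.IH[OF F(1)] C_strip_Suc_imp[OF Suc.prems]])
qed

section \<open>Commuting partial derivatives\<close>

lemma smooth_strip_continuous: "smooth_strip f \<Longrightarrow> strip_continuous f"
  unfolding smooth_strip_def using C_strip_continuous by blast

text \<open>Differentiate \<open>f s t = f s 0 + \<integral>\<^sub>0\<^sup>t f\<^sub>t s\<close> under the integral sign in \<open>s\<close>, then in \<open>t\<close>.\<close>

lemma mixed_partials_commute:
  assumes f: "smooth_strip f" and t: "t \<in> unit_ivl"
  shows "Dt (Dx f s) t = Dx (\<lambda>s. Dt (f s)) s t"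
proof -
  let ?g = "\<lambda>s. Dt (f s)"
  note F = smooth_strip_partials[OF f] and G = smooth_strip_partials[OF smooth_strip_partials(3)[OF f]]
  have eq: "f s t = f s 0 + primitive ?g s t" if t: "t \<in> unit_ivl" for s t
  proof -
    have "(?g s has_integral f s t - f s 0) {0..t}"
      using t by (intro fundamental_theorem_of_calculus
          has_vector_derivative_within_subset[OF strip_partials_vderiv(2)[OF F(1)]]) auto
    then show ?thesis by (simp add: primitive_def integral_unique)
  qed
  have "Dx f s t = Dx f s 0 + primitive (Dx ?g) s t" if t: "t \<in> unit_ivl" for t
  proof -
    have "((\<lambda>u. f u 0 + primitive ?g u t) has_vector_derivative Dx f s 0 + primitive (Dx ?g) s t) (at s)"
      using t strip_partials_vderiv(1)[OF G(1)]
      by (intro has_vector_derivative_add strip_partials_vderiv(1)[OF F(1)]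
          primitive_vderiv_s smooth_strip_continuous F G) auto
    then have "((\<lambda>u. f u t) has_vector_derivative Dx f s 0 + primitive (Dx ?g) s t) (at s)"
      by (simp add: eq[OF t, symmetric])
    then show ?thesis by (simp add: Dx_def vector_derivative_at)
  qed
  then have "Dt (Dx f s) t = Dt (\<lambda>t. Dx f s 0 + primitive (Dx ?g) s t) t"
    using t by (rule Dt_cong)
  also have "\<dots> = Dx ?g s t"
    using has_vector_derivative_add[OF has_vector_derivative_const
        primitive_vderiv_t[OF smooth_strip_continuous[OF G(2)] t]] t
    by (intro Dt_eqI) auto
  finally show ?thesis .
qed

lemma smooth_strip_Dt_pow: "smooth_strip f \<Longrightarrow> smooth_strip (\<lambda>s. (Dt ^^ m) (f s))"
proof (induction m)
  case (Suc m)
  from smooth_strip_partials(3)[OF Suc.IH[OF Suc.prems]] show ?case by simp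
qed simp

lemma Dt_pow_Dx:
  assumes f: "smooth_strip f" and t: "t \<in> unit_ivl"
  shows "(Dt ^^ m) (Dx f s) t = Dx (\<lambda>s. (Dt ^^ m) (f s)) s t"
  using t
proof (induction m arbitrary: t)
  case (Suc m)
  have "(Dt ^^ Suc m) (Dx f s) t = Dt (Dx (\<lambda>s. (Dt ^^ m) (f s)) s) t"
    using Dt_cong[OF Suc.IH Suc.prems] by simp
  also have "\<dots> = Dx (\<lambda>s. (Dt ^^ Suc m) (f s)) s t"
    using mixed_partials_commute[OF smooth_strip_Dt_pow[OF f] Suc.prems] by simp
  finally show ?case .
qed simp

lemma strip_slice_in_Cinf:
  assumes "smooth_strip f"
  shows "restrict (f s) unit_ivl \<in> Cinf"
proof (rule Cinf_if_Dt_pow_differentiable)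
  show "(Dt ^^ m) (f s) differentiable (at t within unit_ivl)" if t: "t \<in> unit_ivl" for m t
    using strip_partials_vderiv(2)[OF smooth_strip_partials(1)[OF smooth_strip_Dt_pow[OF assms]] t]
    by (rule differentiableI_vector)
qed

section \<open>Curves of smooth functions as functions on the strip\<close>

text \<open>By the mean value inequality the error is at most the oscillation of the derivative between \<open>s\<close> and
  \<open>u\<close>, which is uniformly small on the compact set \<open>[s - 1, s + 1] \<times> [0,1]\<close>.\<close>

lemma difference_quotients_uniform:
  assumes f: "smooth_strip f"
  shows "uniform_limit unit_ivl (\<lambda>u t. (f u t - f s t) /\<^sub>R (u - s)) (Dx f s) (at s)"
proof (rule uniform_limitI)
  fix e :: real assume e: "e > 0"
  note F = smooth_strip_partials[OF f]
  have "uniformly_continuous_on (cball s 1 \<times> unit_ivl) (\<lambda>p. Dx f (fst p) (snd p))"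
    by (intro compact_uniformly_continuous compact_Times compact_cball compact_Icc
        continuous_on_subset[OF smooth_strip_continuous[OF F(2), unfolded strip_continuous_def]]) auto
  then obtain d where d: "d > 0" "\<And>p q. p \<in> cball s 1 \<times> unit_ivl \<Longrightarrow> q \<in> cball s 1 \<times> unit_ivl \<Longrightarrow>
      dist p q < d \<Longrightarrow> dist (Dx f (fst p) (snd p)) (Dx f (fst q) (snd q)) < e / 2"
    using e unfolding uniformly_continuous_on_def by (metis half_gt_zero)
  have "dist ((f u t - f s t) /\<^sub>R (u - s)) (Dx f s t) < e"
    if u: "u \<noteq> s" "dist u s < min 1 d" and t: "t \<in> unit_ivl" for u t
  proof -
    have "norm (f u t - f s t - (u - s) *\<^sub>R Dx f s t) \<le> norm (u - s) * (e / 2)"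
    proof (rule vector_differentiable_bound_linearization[where S = "closed_segment s u" and
          f = "\<lambda>u. f u t" and f' = "\<lambda>u. Dx f u t"])
      show "((\<lambda>u. f u t) has_vector_derivative Dx f x t) (at x within closed_segment s u)" for x
        by (rule has_vector_derivative_at_within[OF strip_partials_vderiv(1)[OF F(1) t]])
      show "norm (Dx f x t - Dx f s t) \<le> e / 2" if "x \<in> closed_segment s u" for x
      proof -
        have "dist s x \<le> dist s u"
          using dist_in_closed_segment(1)[OF that] by (simp add: dist_commute)
        then show ?thesis
          using d(2)[of "(x, t)" "(s, t)"] u t
          by (simp add: dist_norm[symmetric] dist_Pair_Pair dist_commute less_imp_le)
      qed
    qed auto
    moreover have "(f u t - f s t) /\<^sub>R (u - s) - Dx f s t
        = (f u t - f s t - (u - s) *\<^sub>R Dx f s t) /\<^sub>R (u - s)"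
      using u by (simp add: scaleR_diff_right)
    ultimately have "dist ((f u t - f s t) /\<^sub>R (u - s)) (Dx f s t) \<le> e / 2"
      using u by (simp only: dist_norm norm_scaleR norm_inverse) (simp add: field_simps)
    then show ?thesis using e by simp
  qed
  then show "\<forall>\<^sub>F u in at s. \<forall>t\<in>unit_ivl. dist ((f u t - f s t) /\<^sub>R (u - s)) (Dx f s t) < e"
    unfolding eventually_at using d(1) by (intro exI[of _ "min 1 d"]) auto
qed

lemma vderiv_iff_difference_quotient:
  fixes f :: "real \<Rightarrow> 'a::real_normed_vector"
  shows "(f has_vector_derivative d) (at s) \<longleftrightarrow> ((\<lambda>u. (f u - f s) /\<^sub>R (u - s)) \<longlongrightarrow> d) (at s)"
proof -
  have "(f has_vector_derivative d) (at s) \<longleftrightarrow>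
      ((\<lambda>u. norm ((f u - f s) - (u - s) *\<^sub>R d) / norm (u - s)) \<longlongrightarrow> 0) (at s)"
    by (simp add: has_vector_derivative_def has_derivative_iff_norm bounded_linear_scaleR_left)
  also have "\<dots> \<longleftrightarrow> ((\<lambda>u. norm ((f u - f s) /\<^sub>R (u - s) - d)) \<longlongrightarrow> 0) (at s)"
  proof (rule filterlim_cong[OF refl refl])
    have "norm (f u - f s - (u - s) *\<^sub>R d) / norm (u - s) = norm ((f u - f s) /\<^sub>R (u - s) - d)"
      if "u \<noteq> s" for u
    proof -
      have "(f u - f s) /\<^sub>R (u - s) - d = (f u - f s - (u - s) *\<^sub>R d) /\<^sub>R (u - s)"
        using that by (simp add: scaleR_diff_right)
      then show ?thesis by (simp add: divide_inverse mult.commute)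
    qed
    then show "\<forall>\<^sub>F u in at s. norm (f u - f s - (u - s) *\<^sub>R d) / norm (u - s)
        = norm ((f u - f s) /\<^sub>R (u - s) - d)"
      by (auto simp: eventually_at_filter)
  qed
  also have "\<dots> \<longleftrightarrow> ((\<lambda>u. (f u - f s) /\<^sub>R (u - s)) \<longlongrightarrow> d) (at s)"
    by (simp only: tendsto_norm_zero_iff LIM_zero_iff)
  finally show ?thesis .
qed

lemma Cinf_derivative_uniform:
  assumes "\<And>u. \<gamma> u \<in> Cinf" "has_Cinf_derivative \<gamma> v s"
  shows "uniform_limit unit_ivl (\<lambda>u t. ((Dt ^^ m) (\<gamma> u) t - (Dt ^^ m) (\<gamma> s) t) /\<^sub>R (u - s))
           ((Dt ^^ m) v) (at s)"
proof -
  have "uniform_limit unit_ivl (\<lambda>u. (Dt ^^ m) (\<lambda>t. (\<gamma> u t - \<gamma> s t) /\<^sub>R (u - s))) ((Dt ^^ m) v) (at s)"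
    using assms(2) by (simp add: has_Cinf_derivative_def)
  then show ?thesis
    by (rule uniform_limit_cong'[THEN iffD1, rotated 2]) (use Dt_pow_linear[OF assms(1,1)] in auto)
qed

lemma Cinf_derivative_vderiv:
  assumes "\<And>u. \<gamma> u \<in> Cinf" "has_Cinf_derivative \<gamma> v s" "t \<in> unit_ivl"
  shows "((\<lambda>u. (Dt ^^ m) (\<gamma> u) t) has_vector_derivative (Dt ^^ m) v t) (at s)"
  unfolding vderiv_iff_difference_quotient
  by (rule tendsto_uniform_limitI[OF Cinf_derivative_uniform[OF assms(1,2)] assms(3)])

text \<open>Convergence of the difference quotients, uniform in \<open>t\<close>, makes the curve Lipschitz at each \<open>s\<close> uniformly
  in \<open>t\<close>; together with continuity in \<open>t\<close> at fixed \<open>s\<close> this is joint continuity.\<close>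

lemma Cinf_derivative_strip_continuous:
  assumes \<gamma>: "\<And>u. \<gamma> u \<in> Cinf" and v: "\<And>s. has_Cinf_derivative \<gamma> (v s) s"
  shows "strip_continuous (\<lambda>s. (Dt ^^ m) (\<gamma> s))"
  unfolding strip_continuous_def continuous_on_iff
proof (intro ballI allI impI)
  fix p :: "real \<times> real" and e :: real
  assume p: "p \<in> UNIV \<times> unit_ivl" and e: "e > 0"
  obtain s t where st: "p = (s, t)" by (cases p)
  have t: "t \<in> unit_ivl" using p st by simp
  let ?F = "\<lambda>s. (Dt ^^ m) (\<gamma> s)" and ?v = "(Dt ^^ m) (v s)"
  have "v s \<in> Cinf" using v by (simp add: has_Cinf_derivative_def)
  then have "bounded (?v ` unit_ivl)"
    by (intro compact_imp_bounded compact_continuous_image Cinf_Dt_pow_continuous) auto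
  then obtain B where B: "B > 0" "\<And>t. t \<in> unit_ivl \<Longrightarrow> norm (?v t) \<le> B"
    unfolding bounded_pos by auto
  obtain d where d: "d > 0" "\<And>u t. u \<noteq> s \<Longrightarrow> dist u s < d \<Longrightarrow> t \<in> unit_ivl \<Longrightarrow>
      dist ((?F u t - ?F s t) /\<^sub>R (u - s)) (?v t) < 1"
    using uniform_limitD[OF Cinf_derivative_uniform[OF \<gamma> v], of 1 s m]
    unfolding eventually_at by auto
  have lip: "dist (?F u t) (?F s t) \<le> dist u s * (B + 1)" if "dist u s < d" "t \<in> unit_ivl" for u t
  proof (cases "u = s")
    case False
    have "norm ((?F u t - ?F s t) /\<^sub>R (u - s)) \<le> norm (?v t) + 1"
      using d(2)[OF False that] norm_triangle_sub[of "(?F u t - ?F s t) /\<^sub>R (u - s)" "?v t"]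
      by (simp add: dist_norm)
    also have "\<dots> \<le> B + 1" using B(2)[OF that(2)] by simp
    finally show ?thesis
      using False by (simp only: dist_norm norm_scaleR norm_inverse) (simp add: field_simps)
  qed simp
  obtain d' where d': "d' > 0" "\<And>t'. t' \<in> unit_ivl \<Longrightarrow> dist t' t < d' \<Longrightarrow> dist (?F s t') (?F s t) < e / 2"
    using Cinf_Dt_pow_continuous[OF \<gamma>, of m s] t e unfolding continuous_on_iff
    by (metis half_gt_zero)
  have "dist (?F u t') (?F s t) < e"
    if u: "t' \<in> unit_ivl" "dist (u, t') (s, t) < min (min d d') (e / 2 / (B + 1))" for u t'
  proof -
    have "dist u s < d" "dist u s < e / 2 / (B + 1)" "dist t' t < d'"
      using u(2) dist_fst_le[of "(u, t')" "(s, t)"] dist_snd_le[of "(u, t')" "(s, t)"] by auto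
    then have "dist (?F u t') (?F s t') < e / 2" "dist (?F s t') (?F s t) < e / 2"
      using lip[OF _ u(1), of u] d'(2)[OF u(1)] B(1) by (auto simp: field_simps)
    then show ?thesis
      using dist_triangle[of "?F u t'" "?F s t" "?F s t'"] by simp
  qed
  then show "\<exists>d>0. \<forall>x'\<in>UNIV \<times> unit_ivl. dist x' p < d \<longrightarrow>
      dist (?F (fst x') (snd x')) (?F (fst p) (snd p)) < e"
    using d d' B e by (intro exI[of _ "min (min d d') (e / 2 / (B + 1))"]) (auto simp: st)
qed

text \<open>The functions \<open>(Dt ^^ m) (\<delta> n s)\<close>, with \<open>\<delta> n\<close> the \<open>n\<close>-th derivative of the curve, form the
  family of all mixed partial derivatives.\<close>

lemma smooth_curve_imp_strip:
  assumes "smooth_curve M \<gamma>" "M \<subseteq> Cinf"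
  shows "smooth_strip \<gamma>"
proof -
  obtain \<delta> where \<delta>: "\<delta> 0 = \<gamma>" "\<And>n s. has_Cinf_derivative (\<delta> n) (\<delta> (Suc n) s) s"
    and \<gamma>: "\<And>s. \<gamma> s \<in> M"
    using assms(1) unfolding smooth_curve_def by auto
  have C: "\<delta> n s \<in> Cinf" for n s
    using \<delta>(2)[of "n - 1" s] \<gamma>[of s] \<delta>(1) assms(2)
    by (cases n) (auto simp: has_Cinf_derivative_def)
  have "smooth_strip (\<lambda>s. (Dt ^^ m) (\<delta> n s))" for n m
  proof (rule smooth_stripI_family[where F = "\<lambda>n m s. (Dt ^^ m) (\<delta> n s)"])
    show "strip_continuous (\<lambda>s. (Dt ^^ m) (\<delta> n s))" for n m
      by (rule Cinf_derivative_strip_continuous[OF C \<delta>(2)])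
    show "strip_partials (\<lambda>s. (Dt ^^ m) (\<delta> n s)) (\<lambda>s. (Dt ^^ m) (\<delta> (Suc n) s))
        (\<lambda>s. (Dt ^^ Suc m) (\<delta> n s))" for n m
      unfolding strip_partials_def
      using Cinf_derivative_vderiv[OF C \<delta>(2)] Cinf_Dt_pow_vderiv[OF C] by auto
  qed
  from this[of 0 0] show ?thesis by (simp add: \<delta>(1))
qed

text \<open>For each \<open>m\<close> the statement is uniform convergence of the difference quotients of \<open>\<partial>\<^sub>t\<^sup>m f\<close> to
  \<open>\<partial>\<^sub>s \<partial>\<^sub>t\<^sup>m f\<close>, whereas the definition asks for the limit \<open>\<partial>\<^sub>t\<^sup>m \<partial>\<^sub>s f\<close>: here the mixed partial
  derivatives have to agree.\<close>

lemma smooth_strip_has_Cinf_derivative: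
  assumes f: "smooth_strip f"
  shows "has_Cinf_derivative (\<lambda>s. restrict (f s) unit_ivl) (restrict (Dx f s) unit_ivl) s"
proof -
  note C = strip_slice_in_Cinf[OF f]
  have "uniform_limit unit_ivl
      (\<lambda>u. (Dt ^^ m) (\<lambda>t. (restrict (f u) unit_ivl t - restrict (f s) unit_ivl t) /\<^sub>R (u - s)))
      ((Dt ^^ m) (restrict (Dx f s) unit_ivl)) (at s)" for m
  proof (rule uniform_limit_cong'[THEN iffD2])
    show "uniform_limit unit_ivl (\<lambda>u t. ((Dt ^^ m) (f u) t - (Dt ^^ m) (f s) t) /\<^sub>R (u - s))
        (Dx (\<lambda>s. (Dt ^^ m) (f s)) s) (at s)"
      by (rule difference_quotients_uniform[OF smooth_strip_Dt_pow[OF f]])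
    fix t :: real assume t: "t \<in> unit_ivl"
    have r: "(Dt ^^ m) (restrict g unit_ivl) t = (Dt ^^ m) g t" for g
      using t by (intro Dt_pow_cong) auto
    show "(Dt ^^ m) (restrict (Dx f s) unit_ivl) t = Dx (\<lambda>s. (Dt ^^ m) (f s)) s t"
      by (simp add: r Dt_pow_Dx[OF f t])
    show "(Dt ^^ m) (\<lambda>t. (restrict (f u) unit_ivl t - restrict (f s) unit_ivl t) /\<^sub>R (u - s)) t
        = ((Dt ^^ m) (f u) t - (Dt ^^ m) (f s) t) /\<^sub>R (u - s)" for u
      by (simp only: Dt_pow_linear[OF C C t] r)
  qed
  then show ?thesis
    using strip_slice_in_Cinf[OF smooth_strip_partials(2)[OF f]] by (simp add: has_Cinf_derivative_def)
qed

lemma strip_imp_smooth_curve: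
  assumes f: "smooth_strip f" and M: "\<And>s. restrict (f s) unit_ivl \<in> M"
  shows "smooth_curve M (\<lambda>s. restrict (f s) unit_ivl)"
proof -
  have "smooth_strip ((Dx ^^ n) f)" for n
    by (induction n) (use f smooth_strip_partials(2) in auto)
  from smooth_strip_has_Cinf_derivative[OF this]
  show ?thesis
    unfolding smooth_curve_def
    using M by (intro conjI allI exI[of _ "\<lambda>n s. restrict ((Dx ^^ n) f s) unit_ivl"]) auto
qed

lemma restrict_Cinf: "f \<in> Cinf \<Longrightarrow> restrict f unit_ivl = f"
  by (auto simp: Cinf_def extensional_restrict)

text \<open>Through this lemma the constructions for smooth curves apply to single functions as well.\<close>

lemma smooth_curve_const:
  assumes "c \<in> M" "M \<subseteq> Cinf"
  shows "smooth_curve M (\<lambda>s. c)"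
proof -
  have c: "c \<in> Cinf" using assms by auto
  have "smooth_strip (\<lambda>s t. if n = 0 then (Dt ^^ m) c t else 0)" for n m :: nat
  proof (rule smooth_stripI_family[where F = "\<lambda>n m s t. if n = 0 then (Dt ^^ m) c t else 0"])
    show "strip_continuous (\<lambda>s t. if n = 0 then (Dt ^^ m) c t else 0)" for n m :: nat
      unfolding strip_continuous_def
      by (cases "n = 0") (auto intro!: continuous_on_compose2[OF Cinf_Dt_pow_continuous[OF c]] continuous_intros)
    show "strip_partials (\<lambda>s t. if n = 0 then (Dt ^^ m) c t else 0)
        (\<lambda>s t. if Suc n = 0 then (Dt ^^ m) c t else 0)
        (\<lambda>s t. if n = 0 then (Dt ^^ Suc m) c t else 0)" for n m :: nat
      using Cinf_Dt_pow_vderiv[OF c, of _ m]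
      by (cases "n = 0") (auto simp: strip_partials_def)
  qed
  from this[of 0 0] have "smooth_strip (\<lambda>s. c)" by simp
  from strip_imp_smooth_curve[OF this, of M] show ?thesis
    using assms(1) by (simp add: restrict_Cinf[OF c])
qed

section \<open>The transform in logarithmic coordinates\<close>

text \<open>Halving the real part takes the square root of the speed, and the factor \<open>a / (2 b)\<close> is the power to
  which the unit tangent is raised.\<close>

definition twist :: "real \<Rightarrow> real \<Rightarrow> complex \<Rightarrow> complex" where
  "twist a b z = Complex (Re z / 2) (a / (2 * b) * Im z)"

definition untwist :: "real \<Rightarrow> real \<Rightarrow> complex \<Rightarrow> complex" where
  "untwist a b z = Complex (2 * Re z) (2 * b / a * Im z)"

definition log_transform :: "real \<Rightarrow> real \<Rightarrow> complex \<Rightarrow> complex" where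
  "log_transform a b z = of_real (ln (2 * b)) + twist a b z"

lemma twist_sel [simp]: "Re (twist a b z) = Re z / 2" "Im (twist a b z) = a / (2 * b) * Im z"
  by (auto simp: twist_def)

lemma untwist_sel [simp]: "Re (untwist a b z) = 2 * Re z" "Im (untwist a b z) = 2 * b / a * Im z"
  by (auto simp: untwist_def)

lemma bounded_linear_complexI:
  assumes "\<And>x y. L (x + y) = L x + L y" "\<And>r x. L (r *\<^sub>R x) = r *\<^sub>R (L x :: complex)"
  shows "bounded_linear (L :: complex \<Rightarrow> complex)"
  using assms by (intro linear_conv_bounded_linear[THEN iffD1] linearI) auto

lemma bounded_linear_twist: "bounded_linear (twist a b)"
  by (rule bounded_linear_complexI) (auto simp: complex_eq_iff algebra_simps add_divide_distrib)

lemma bounded_linear_untwist: "bounded_linear (untwist a b)"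
  by (rule bounded_linear_complexI) (auto simp: complex_eq_iff algebra_simps add_divide_distrib)

lemma twist_untwist: "a > 0 \<Longrightarrow> b > 0 \<Longrightarrow> twist a b (untwist a b z) = z"
  by (simp add: complex_eq_iff)

lemma Imm0_Cinf: "Imm0 \<subseteq> Cinf" and Cinf_star_Cinf: "Cinf_star \<subseteq> Cinf"
  by (auto simp: Imm0_def Cinf_star_def)

lemma F_value_eq_exp:
  assumes "b > 0" "l = Complex (ln r) \<theta>" "r > 0"
  shows "2 * b * sqrt r * exp (\<i> * \<theta> * (a / (2 * b))) = exp (log_transform a b l)"
proof -
  have "log_transform a b l = of_real (ln (2 * b) + ln r / 2) + \<i> * \<theta> * (a / (2 * b))"
    using assms by (simp add: log_transform_def complex_eq_iff)
  moreover have "exp (ln (2 * b) + ln r / 2) = 2 * b * sqrt r"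
    using assms by (simp add: exp_add ln_sqrt[symmetric])
  ultimately show ?thesis
    by (simp only: exp_add exp_of_real) simp
qed

text \<open>A continuous angle \<open>\<theta>\<close> of \<open>c'\<close> corresponds to the continuous logarithm \<open>ln \<bar>c'\<bar> + \<i> \<theta>\<close>.\<close>

lemma F_values_iff_logarithm:
  assumes "b > 0" "c \<in> Imm0"
  shows "q \<in> F_values a b c \<longleftrightarrow> (\<exists>l. continuous_on unit_ivl l \<and>
    (\<forall>t\<in>unit_ivl. Dt c t = exp (l t)) \<and> q = (\<lambda>t\<in>unit_ivl. exp (log_transform a b (l t))))"
proof
  have c: "c \<in> Cinf" and nz: "\<And>t. t \<in> unit_ivl \<Longrightarrow> Dt c t \<noteq> 0"
    using assms(2) by (auto simp: Imm0_def)
  assume "q \<in> F_values a b c"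
  then obtain \<theta> :: "real \<Rightarrow> real" where \<theta>: "continuous_on unit_ivl \<theta>"
    and D: "\<And>t. t \<in> unit_ivl \<Longrightarrow> Dt c t = norm (Dt c t) * exp (\<i> * \<theta> t)"
    and q: "q = (\<lambda>t\<in>unit_ivl. 2 * b * sqrt (norm (Dt c t)) * exp (\<i> * \<theta> t * (complex_of_real a / (2 * complex_of_real b))))"
    unfolding F_values_def mem_Collect_eq by (elim exE conjE) (rule that; fastforce)
  let ?l = "\<lambda>t. Complex (ln (norm (Dt c t))) (\<theta> t)"
  have "continuous_on unit_ivl ?l"
    by (intro continuous_on_Complex \<theta> continuous_on_ln continuous_on_norm Cinf_Dt_continuous c)
      (use nz in auto)
  moreover have "Dt c t = exp (?l t)" if t: "t \<in> unit_ivl" for t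
  proof -
    have "exp (?l t) = of_real (exp (ln (norm (Dt c t)))) * exp (\<i> * \<theta> t)"
      by (simp only: Complex_eq exp_add exp_of_real)
    then show ?thesis using D[OF t] nz[OF t] by simp
  qed
  moreover have "q = (\<lambda>t\<in>unit_ivl. exp (log_transform a b (?l t)))"
    unfolding q
  proof (rule restrict_ext)
    fix t :: real assume "t \<in> unit_ivl"
    then show "2 * b * sqrt (norm (Dt c t)) * exp (\<i> * \<theta> t * (complex_of_real a / (2 * complex_of_real b)))
        = exp (log_transform a b (?l t))"
      using F_value_eq_exp[OF assms(1) refl, where r = "norm (Dt c t)" and \<theta> = "\<theta> t" and a = a] nz
      by simp
  qed
  ultimately show "\<exists>l. continuous_on unit_ivl l \<and>
    (\<forall>t\<in>unit_ivl. Dt c t = exp (l t)) \<and> q = (\<lambda>t\<in>unit_ivl. exp (log_transform a b (l t)))"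
    by (intro exI[of _ ?l]) blast
next
  assume "\<exists>l. continuous_on unit_ivl l \<and>
    (\<forall>t\<in>unit_ivl. Dt c t = exp (l t)) \<and> q = (\<lambda>t\<in>unit_ivl. exp (log_transform a b (l t)))"
  then obtain l where l: "continuous_on unit_ivl l" "\<And>t. t \<in> unit_ivl \<Longrightarrow> Dt c t = exp (l t)"
    and q: "q = (\<lambda>t\<in>unit_ivl. exp (log_transform a b (l t)))" by blast
  let ?\<theta> = "\<lambda>t. Im (l t)"
  have "continuous_on unit_ivl ?\<theta>" using l(1) by (intro continuous_intros)
  moreover have "Dt c t = norm (Dt c t) * exp (\<i> * ?\<theta> t)" if "t \<in> unit_ivl" for t
    unfolding l(2)[OF that] by (subst exp_eq_polar) (simp add: cis_conv_exp)
  moreover have "q = (\<lambda>t\<in>unit_ivl. 2 * b * sqrt (norm (Dt c t)) * exp (\<i> * ?\<theta> t * (complex_of_real a / (2 * complex_of_real b))))"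
    unfolding q
  proof (rule restrict_ext)
    fix t :: real assume t: "t \<in> unit_ivl"
    have "l t = Complex (ln (norm (Dt c t))) (?\<theta> t)" by (simp add: l(2)[OF t] complex_eq_iff)
    moreover have "norm (Dt c t) > 0" by (simp add: l(2)[OF t])
    ultimately show "exp (log_transform a b (l t))
        = 2 * b * sqrt (norm (Dt c t)) * exp (\<i> * ?\<theta> t * (complex_of_real a / (2 * complex_of_real b)))"
      using F_value_eq_exp[OF assms(1), where r = "norm (Dt c t)" and \<theta> = "?\<theta> t" and a = a] by simp
  qed
  ultimately show "q \<in> F_values a b c"
    unfolding F_values_def mem_Collect_eq by (intro exI[of _ ?\<theta>]) simp
qed

text \<open>The difference of the two logarithms is continuous and is a logarithm of the constant \<open>exp (\<i> \<psi>)\<close>.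
  Its values therefore lie in a discrete set, and on a connected interval it is constant; its real
  part vanishes because \<open>exp (\<i> \<psi>)\<close> has modulus one.\<close>

lemma logarithms_of_rotated:
  assumes "continuous_on unit_ivl l" "continuous_on unit_ivl l'"
    and e: "\<And>t. t \<in> unit_ivl \<Longrightarrow> exp (l' t) = exp (\<i> * of_real \<psi>) * exp (l t)"
  obtains \<alpha> :: real where "\<And>t. t \<in> unit_ivl \<Longrightarrow> l' t = l t + \<i> * \<alpha>"
proof -
  define d where "d t = l' t - l t" for t
  have ed: "exp (d t) = exp (\<i> * of_real \<psi>)" if "t \<in> unit_ivl" for t
    using e[OF that] by (simp add: d_def exp_diff)
  have "d constant_on unit_ivl"
  proof (rule continuous_discrete_range_constant)
    show "continuous_on unit_ivl d"
      unfolding d_def by (intro continuous_intros assms)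
    fix x :: real assume x: "x \<in> unit_ivl"
    have "2 * pi \<le> norm (d y - d x)" if y: "y \<in> unit_ivl" "d y \<noteq> d x" for y
    proof -
      have "\<not> \<bar>Im (d y) - Im (d x)\<bar> < 2 * pi"
        using exp_complex_eqI[of "d y" "d x"] y ed x by auto
      then show ?thesis using abs_Im_le_cmod[of "d y - d x"] by simp
    qed
    then show "\<exists>e>0. \<forall>y. y \<in> unit_ivl \<and> d y \<noteq> d x \<longrightarrow> e \<le> norm (d y - d x)"
      by (intro exI[of _ "2 * pi"]) auto
  qed auto
  then have d0: "d t = d 0" if "t \<in> unit_ivl" for t
    using that by (auto simp: constant_on_def)
  have "Re (d 0) = 0"
    using arg_cong[OF ed[of 0], of norm] by simp
  then have "d 0 = \<i> * Im (d 0)" by (simp add: complex_eq_iff)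
  then show ?thesis using d0 by (intro that[of "Im (d 0)"]) (metis d_def add_diff_cancel_left' diff_add_cancel add.commute)
qed

lemma log_transform_shift:
  "log_transform a b (z + \<i> * of_real \<alpha>) = log_transform a b z + \<i> * of_real (a / (2 * b) * \<alpha>)"
  by (simp add: log_transform_def complex_eq_iff algebra_simps add_divide_distrib)

lemma log_transform_eq_shift:
  assumes "a > 0" "b > 0" "log_transform a b z' = log_transform a b z + \<i> * of_real \<alpha>"
  shows "z' = z + \<i> * of_real (2 * b / a * \<alpha>)"
  using assms by (simp add: log_transform_def complex_eq_iff field_simps)

section \<open>Rotation orbits and the transform\<close>

lemma rot_orbit_rot: "rot_orbit (rot \<psi> f) = rot_orbit f"
proof -
  have r: "rot \<phi> (rot \<psi> f) = rot (\<phi> + \<psi>) f" for \<phi> \<psi> f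
    by (auto simp: rot_def exp_add ring_distribs mult.assoc)
  have "rot \<phi> f \<in> rot_orbit (rot \<psi> f)" for \<phi>
    unfolding rot_orbit_def by (rule range_eqI[of _ _ "\<phi> - \<psi>"]) (simp add: r)
  then show ?thesis by (auto simp: rot_orbit_def r)
qed

lemma rot_orbit_refl: "f \<in> extensional unit_ivl \<Longrightarrow> f \<in> rot_orbit f"
  by (auto simp: rot_orbit_def rot_def image_def extensional_restrict intro!: exI[of _ 0])

lemma rot_orbit_eqE:
  assumes "rot_orbit f = rot_orbit g" "f \<in> extensional unit_ivl"
  obtains \<psi> where "f = rot \<psi> g"
  using rot_orbit_refl[OF assms(2)] assms(1) by (auto simp: rot_orbit_def)

lemma Dt_rot:
  assumes "c \<in> Cinf" "t \<in> unit_ivl"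
  shows "Dt (rot \<psi> c) t = exp (\<i> * \<psi>) * Dt c t"
proof -
  have "Dt (rot \<psi> c) t = Dt (\<lambda>t. exp (\<i> * \<psi>) * c t) t"
    using assms(2) by (intro Dt_cong) (auto simp: rot_def)
  also have "\<dots> = exp (\<i> * \<psi>) * Dt c t"
    using assms by (intro Dt_eqI has_vector_derivative_mult_right Cinf_vderiv)
  finally show ?thesis .
qed

lemma Imm0_eq_integral:
  assumes "c \<in> Imm0" "t \<in> unit_ivl"
  shows "(Dt c has_integral c t) {0..t}"
proof -
  have "(Dt c has_integral c t - c 0) {0..t}"
    using assms by (intro fundamental_theorem_of_calculus
        has_vector_derivative_within_subset[OF Cinf_vderiv]) (auto simp: Imm0_def)
  then show ?thesis using assms by (simp add: Imm0_def)
qed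

text \<open>A rotation of \<open>c\<close> by \<open>\<psi>\<close> adds \<open>\<i> \<alpha>\<close> to the logarithm, with \<open>\<alpha>\<close> congruent to \<open>\<psi>\<close> modulo \<open>2 \<pi>\<close>,
  and rotates the value of the transform by \<open>a \<alpha> / (2 b)\<close>. With \<open>\<psi> = 0\<close> this covers the different
  values for the same \<open>c\<close>.\<close>

lemma F_values_same_orbit:
  assumes ab: "b > 0" and c: "c \<in> Imm0" "c' \<in> Imm0" "c' = rot \<psi> c"
    and q: "q \<in> F_values a b c" "q' \<in> F_values a b c'"
  shows "rot_orbit q' = rot_orbit q"
proof -
  obtain l where l: "continuous_on unit_ivl l" "\<And>t. t \<in> unit_ivl \<Longrightarrow> Dt c t = exp (l t)"
      "q = (\<lambda>t\<in>unit_ivl. exp (log_transform a b (l t)))"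
    using q(1) F_values_iff_logarithm[OF ab c(1)] by blast
  obtain l' where l': "continuous_on unit_ivl l'" "\<And>t. t \<in> unit_ivl \<Longrightarrow> Dt c' t = exp (l' t)"
      "q' = (\<lambda>t\<in>unit_ivl. exp (log_transform a b (l' t)))"
    using q(2) F_values_iff_logarithm[OF ab c(2)] by blast
  have "exp (l' t) = exp (\<i> * of_real \<psi>) * exp (l t)" if "t \<in> unit_ivl" for t
    using l(2) l'(2) Dt_rot[of c t \<psi>] c Imm0_Cinf that by auto
  then obtain \<alpha> :: real where \<alpha>: "\<And>t. t \<in> unit_ivl \<Longrightarrow> l' t = l t + \<i> * \<alpha>"
    using logarithms_of_rotated[OF l(1) l'(1)] by blast
  have "q' = rot (a / (2 * b) * \<alpha>) q"
    unfolding rot_def l(3) l'(3)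
    by (intro restrict_ext) (simp add: \<alpha> log_transform_shift exp_add mult.commute del: of_real_mult of_real_divide)
  then show ?thesis by (simp add: rot_orbit_rot)
qed

text \<open>The same argument for the inverse of the affine map shows that the derivatives differ by a rotation.
  Both curves start at \<open>0\<close>, so they differ by the same rotation.\<close>

lemma F_values_orbit_injective:
  assumes ab: "a > 0" "b > 0" and c: "c \<in> Imm0" "c' \<in> Imm0"
    and q: "q \<in> F_values a b c" "q' \<in> F_values a b c'" "rot_orbit q' = rot_orbit q"
  shows "rot_orbit c' = rot_orbit c"
proof -
  obtain l where l: "continuous_on unit_ivl l" "\<And>t. t \<in> unit_ivl \<Longrightarrow> Dt c t = exp (l t)"
      "q = (\<lambda>t\<in>unit_ivl. exp (log_transform a b (l t)))"
    using q(1) F_values_iff_logarithm[OF ab(2) c(1)] by blast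
  obtain l' where l': "continuous_on unit_ivl l'" "\<And>t. t \<in> unit_ivl \<Longrightarrow> Dt c' t = exp (l' t)"
      "q' = (\<lambda>t\<in>unit_ivl. exp (log_transform a b (l' t)))"
    using q(2) F_values_iff_logarithm[OF ab(2) c(2)] by blast
  obtain \<psi> where \<psi>: "q' = rot \<psi> q"
    by (rule rot_orbit_eqE[OF q(3)]) (auto simp: l'(3))
  have cont: "continuous_on unit_ivl (\<lambda>t. log_transform a b (k t))" if "continuous_on unit_ivl k" for k
    unfolding log_transform_def
    by (intro continuous_intros bounded_linear.continuous_on[OF bounded_linear_twist] that)
  have "exp (log_transform a b (l' t)) = exp (\<i> * of_real \<psi>) * exp (log_transform a b (l t))"
    if "t \<in> unit_ivl" for t
    using fun_cong[OF \<psi>, of t] that by (simp add: l(3) l'(3) rot_def)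
  then obtain \<alpha> :: real where \<alpha>: "\<And>t. t \<in> unit_ivl \<Longrightarrow>
      log_transform a b (l' t) = log_transform a b (l t) + \<i> * \<alpha>"
    using logarithms_of_rotated[OF cont[OF l(1)] cont[OF l'(1)]] by blast
  define \<beta> where "\<beta> = 2 * b / a * \<alpha>"
  have D: "Dt c' t = exp (\<i> * \<beta>) * Dt c t" if "t \<in> unit_ivl" for t
    using log_transform_eq_shift[OF ab \<alpha>[OF that]] l(2) l'(2) that
    by (simp add: exp_add \<beta>_def mult.commute)
  have "c' t = rot \<beta> c t" for t
  proof (cases "t \<in> unit_ivl")
    case True
    have "(Dt c' has_integral exp (\<i> * \<beta>) * c t) {0..t}"
      by (rule has_integral_eq[OF _ has_integral_mult_right[OF Imm0_eq_integral[OF c(1) True]]])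
        (use D True in auto)
    then show ?thesis
      using Imm0_eq_integral[OF c(2) True] True by (simp add: rot_def has_integral_unique)
  next
    case False
    then show ?thesis using c(2) by (auto simp: rot_def Imm0_def Cinf_def extensional_def)
  qed
  then have "c' = rot \<beta> c" by blast
  then show ?thesis by (simp add: rot_orbit_rot)
qed

section \<open>Smooth curves under the transform\<close>

lemma smooth_strip_exp: "smooth_strip f \<Longrightarrow> smooth_strip (\<lambda>s t. exp (f s t))"
  by (simp add: smooth_strip_def C_strip_exp)

lemma smooth_strip_linear_shift:
  "bounded_linear L \<Longrightarrow> smooth_strip f \<Longrightarrow> smooth_strip (\<lambda>s t. z + L (f s t))"
  by (simp add: smooth_strip_def C_strip_add C_strip_const C_strip_linear)

lemma transform_smooth_curve:
  assumes ab: "b > 0" and \<gamma>: "smooth_curve Imm0 \<gamma>"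
  obtains \<eta> where "smooth_curve Cinf_star \<eta>" "\<And>s. \<eta> s \<in> F_values a b (\<gamma> s)"
proof -
  have Imm: "\<gamma> s \<in> Imm0" for s using \<gamma> by (simp add: smooth_curve_def)
  have D: "smooth_strip (\<lambda>s. Dt (\<gamma> s))"
    by (rule smooth_strip_partials(3)[OF smooth_curve_imp_strip[OF \<gamma> Imm0_Cinf]])
  obtain l where l: "strip_continuous l" "\<And>s t. t \<in> unit_ivl \<Longrightarrow> Dt (\<gamma> s) t = exp (l s t)"
    by (rule strip_log_exists[OF smooth_strip_continuous[OF D]]) (use Imm in \<open>auto simp: Imm0_def\<close>)
  have e: "smooth_strip (\<lambda>s t. exp (log_transform a b (l s t)))"
    unfolding log_transform_def
    by (intro smooth_strip_exp smooth_strip_linear_shift bounded_linear_twist smooth_strip_log[OF D l])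
  show ?thesis
  proof (rule that)
    show "smooth_curve Cinf_star (\<lambda>s. \<lambda>t\<in>unit_ivl. exp (log_transform a b (l s t)))"
      using strip_slice_in_Cinf[OF e] by (intro strip_imp_smooth_curve[OF e]) (auto simp: Cinf_star_def)
    show "(\<lambda>t\<in>unit_ivl. exp (log_transform a b (l s t))) \<in> F_values a b (\<gamma> s)" for s
      unfolding F_values_iff_logarithm[OF ab Imm]
      using strip_continuous_slice[OF l(1)] l(2) by blast
  qed
qed

text \<open>Take a logarithm of \<open>\<eta>\<close>, undo the affine map, exponentiate and integrate from \<open>0\<close>.\<close>

lemma untransform_smooth_curve:
  assumes ab: "a > 0" "b > 0" and \<eta>: "smooth_curve Cinf_star \<eta>"
  obtains \<gamma> where "smooth_curve Imm0 \<gamma>" "\<And>s. \<eta> s \<in> F_values a b (\<gamma> s)"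
proof -
  have star: "\<eta> s \<in> Cinf_star" for s using \<eta> by (simp add: smooth_curve_def)
  note S = smooth_curve_imp_strip[OF \<eta> Cinf_star_Cinf]
  obtain m where m: "strip_continuous m" "\<And>s t. t \<in> unit_ivl \<Longrightarrow> \<eta> s t = exp (m s t)"
    by (rule strip_log_exists[OF smooth_strip_continuous[OF S]]) (use star in \<open>auto simp: Cinf_star_def\<close>)
  define l where "l s t = untwist a b (- of_real (ln (2 * b)) + m s t)" for s t
  have lm: "log_transform a b (l s t) = m s t" for s t
    by (simp add: log_transform_def l_def twist_untwist[OF ab])
  have "smooth_strip (\<lambda>s t. 0 + untwist a b (- of_real (ln (2 * b)) + m s t))"
    by (intro smooth_strip_linear_shift bounded_linear_untwist
        smooth_strip_linear_shift[OF bounded_linear_ident] smooth_strip_log[OF S m])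
  then have l: "smooth_strip l" by (simp add: l_def[abs_def])
  define g where "g = (\<lambda>s t. exp (l s t))"
  have g: "smooth_strip g" unfolding g_def by (rule smooth_strip_exp[OF l])
  then have p: "smooth_strip (primitive g)" by (simp add: smooth_strip_def C_strip_primitive)
  define \<gamma> where "\<gamma> s = restrict (primitive g s) unit_ivl" for s
  have D: "Dt (\<gamma> s) t = exp (l s t)" if "t \<in> unit_ivl" for s t
  proof -
    have "Dt (\<gamma> s) t = Dt (primitive g s) t"
      using that by (intro Dt_cong) (auto simp: \<gamma>_def)
    also have "\<dots> = g s t"
      using primitive_vderiv_t[OF smooth_strip_continuous[OF g] that] that by (intro Dt_eqI)
    finally show ?thesis by (simp add: g_def)
  qed
  have Imm: "\<gamma> s \<in> Imm0" for s
    using strip_slice_in_Cinf[OF p, of s] D by (auto simp: Imm0_def \<gamma>_def[symmetric]) (simp add: \<gamma>_def primitive_def)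
  show ?thesis
  proof (rule that)
    show "smooth_curve Imm0 \<gamma>"
      unfolding \<gamma>_def by (rule strip_imp_smooth_curve[OF p]) (use Imm in \<open>simp add: \<gamma>_def\<close>)
    have "restrict (\<eta> s) unit_ivl = (\<lambda>t\<in>unit_ivl. exp (log_transform a b (l s t)))" for s
      by (rule restrict_ext) (simp add: lm m(2))
    then have "\<eta> s = (\<lambda>t\<in>unit_ivl. exp (log_transform a b (l s t)))" for s
      using restrict_Cinf[of "\<eta> s"] star[of s] Cinf_star_Cinf by (metis subsetD)
    then show "\<eta> s \<in> F_values a b (\<gamma> s)" for s
      unfolding F_values_iff_logarithm[OF ab(2) Imm]
      using strip_continuous_slice[OF smooth_strip_continuous[OF l]] D by blast
  qed
qed

section \<open>The quotient metrics in logarithmic coordinates\<close>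

text \<open>With \<open>T\<close> the unit tangent, \<open>D\<^sub>s h = T x\<close>; hence \<open>Re x\<close> and \<open>Im x\<close> are its tangential and normal
  components.\<close>

lemma elastic_metric_log_velocity:
  assumes nz: "\<And>t. t \<in> unit_ivl \<Longrightarrow> Dt c t \<noteq> 0"
    and h: "\<And>t. t \<in> unit_ivl \<Longrightarrow> Dt h t = Dt c t * x t"
    and k: "\<And>t. t \<in> unit_ivl \<Longrightarrow> Dt k t = Dt c t * y t"
  shows "elastic_metric a b c h k =
    integral unit_ivl (\<lambda>t. norm (Dt c t) * (a\<^sup>2 * (Im (x t) * Im (y t)) + b\<^sup>2 * (Re (x t) * Re (y t))))"
  unfolding elastic_metric_def
proof (rule integral_cong)
  fix t :: real assume t: "t \<in> unit_ivl"
  define T where "T = unit_tangent c t"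
  have "norm T = 1" using nz[OF t] by (simp add: T_def unit_tangent_def norm_divide)
  then have "T \<bullet> T = 1" by (simp add: dot_square_norm)
  then have T: "Re T * Re T + Im T * Im T = 1" by (simp add: inner_complex_def)
  have "(T * z) \<bullet> T = Re z * (Re T * Re T + Im T * Im T)"
       "(T * z) \<bullet> (\<i> * T) = Im z * (Re T * Re T + Im T * Im T)" for z
    by (simp_all add: inner_complex_def algebra_simps)
  then have inner: "(T * z) \<bullet> T = Re z" "(T * z) \<bullet> (\<i> * T) = Im z" for z
    by (simp_all add: T)
  have "Ds c h t = T * x t" "Ds c k t = T * y t" "unit_normal c t = \<i> * T"
    by (simp_all add: Ds_def T_def unit_tangent_def unit_normal_def h[OF t] k[OF t])
  then show "(a\<^sup>2 * (Ds c h t \<bullet> unit_normal c t) * (Ds c k t \<bullet> unit_normal c t) +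
        b\<^sup>2 * (Ds c h t \<bullet> unit_tangent c t) * (Ds c k t \<bullet> unit_tangent c t)) * norm (Dt c t) =
      norm (Dt c t) * (a\<^sup>2 * (Im (x t) * Im (y t)) + b\<^sup>2 * (Re (x t) * Re (y t)))"
    by (simp add: T_def[symmetric] inner algebra_simps)
qed

lemma L2_metric_log_velocity:
  assumes q: "continuous_on unit_ivl q" and x: "continuous_on unit_ivl x" and y: "continuous_on unit_ivl y"
    and w: "\<And>t. t \<in> unit_ivl \<Longrightarrow> w t = q t * x t"
    and z: "\<And>t. t \<in> unit_ivl \<Longrightarrow> z t = q t * y t"
  shows "L2_metric q w z =
    integral unit_ivl (\<lambda>t. (norm (q t))\<^sup>2 * (Im (x t) * Im (y t) + Re (x t) * Re (y t)))"
proof -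
  have "integral unit_ivl (\<lambda>t. w t * cnj (z t)) = integral unit_ivl (\<lambda>t. q t * x t * cnj (q t * y t))"
    by (intro integral_cong) (simp add: w z)
  moreover have "(\<lambda>t. q t * x t * cnj (q t * y t)) integrable_on unit_ivl"
    by (intro integrable_continuous_real continuous_intros q x y)
  ultimately have "L2_metric q w z = integral unit_ivl (\<lambda>t. Re (q t * x t * cnj (q t * y t)))"
    unfolding L2_metric_def
    using integral_linear[OF _ bounded_linear_Re, of "\<lambda>t. q t * x t * cnj (q t * y t)" unit_ivl]
    by (simp add: o_def)
  also have "\<dots> = integral unit_ivl (\<lambda>t. (norm (q t))\<^sup>2 * (Im (x t) * Im (y t) + Re (x t) * Re (y t)))"
    by (intro integral_cong) (simp only: cmod_power2, simp add: algebra_simps power2_eq_square)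
  finally show ?thesis .
qed

text \<open>The coefficient of the projection of \<open>h\<close>, where \<open>h' = c' x\<close>, onto the direction \<open>\<i> c\<close> of the rotation
  orbit (\<open>elastic_rotation_component\<close>). It is the average of the turning rate \<open>Im x\<close> over arc length.\<close>

definition mean_turning :: "(real \<Rightarrow> complex) \<Rightarrow> (real \<Rightarrow> complex) \<Rightarrow> real" where
  "mean_turning c x =
     integral unit_ivl (\<lambda>t. norm (Dt c t) * Im (x t)) / integral unit_ivl (\<lambda>t. norm (Dt c t))"

lemma Imm0D:
  assumes "c \<in> Imm0"
  shows "c \<in> Cinf" "\<And>t. t \<in> unit_ivl \<Longrightarrow> Dt c t \<noteq> 0" "continuous_on unit_ivl (Dt c)"
  using assms Cinf_Dt_continuous by (auto simp: Imm0_def)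

lemma curve_length_pos:
  assumes "c \<in> Imm0"
  shows "integral unit_ivl (\<lambda>t. norm (Dt c t)) > 0"
proof -
  have c: "continuous_on unit_ivl (\<lambda>t. norm (Dt c t))"
    by (intro continuous_on_norm Imm0D assms)
  obtain t0 where t0: "t0 \<in> unit_ivl" "\<And>t. t \<in> unit_ivl \<Longrightarrow> norm (Dt c t0) \<le> norm (Dt c t)"
    using continuous_attains_inf[OF compact_Icc _ c] by auto
  have "integral unit_ivl (\<lambda>t. norm (Dt c t0)) \<le> integral unit_ivl (\<lambda>t. norm (Dt c t))"
    using t0(2) by (intro integral_le integrable_continuous_real c) auto
  moreover have "0 < norm (Dt c t0)" using Imm0D(2)[OF assms t0(1)] by simp
  moreover have "integral unit_ivl (\<lambda>t. norm (Dt c t0)) = norm (Dt c t0)" by simp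
  ultimately show ?thesis by linarith
qed

lemma Dt_rot_gen:
  assumes "c \<in> Cinf" "t \<in> unit_ivl"
  shows "Dt (rot_gen c) t = Dt c t * \<i>"
proof -
  have "Dt (rot_gen c) t = Dt (\<lambda>t. \<i> * c t) t"
    using assms(2) by (intro Dt_cong) (auto simp: rot_gen_def)
  also have "\<dots> = \<i> * Dt c t"
    using assms by (intro Dt_eqI has_vector_derivative_mult_right Cinf_vderiv)
  finally show ?thesis by simp
qed

lemma Dt_horizontal_part:
  assumes "c \<in> Cinf" "h \<in> Cinf" "t \<in> unit_ivl"
  shows "Dt (horizontal_part g c h) t
    = Dt h t - (g c h (rot_gen c) / g c (rot_gen c) (rot_gen c)) *\<^sub>R (\<i> * Dt c t)"
proof -
  let ?m = "g c h (rot_gen c) / g c (rot_gen c) (rot_gen c)"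
  have "Dt (horizontal_part g c h) t = Dt (\<lambda>t. h t - ?m *\<^sub>R (\<i> * c t)) t"
    using assms(3) by (intro Dt_cong) (auto simp: horizontal_part_def rot_gen_def)
  also have "\<dots> = Dt h t - ?m *\<^sub>R (\<i> * Dt c t)"
    using assms by (intro Dt_eqI has_vector_derivative_diff Cinf_vderiv
        bounded_linear.has_vector_derivative[OF bounded_linear_scaleR_right]
        has_vector_derivative_mult_right)
  finally show ?thesis .
qed

lemma elastic_rotation_component:
  assumes c: "c \<in> Imm0" and a: "a > 0" and h: "\<And>t. t \<in> unit_ivl \<Longrightarrow> Dt h t = Dt c t * x t"
  shows "elastic_metric a b c h (rot_gen c) / elastic_metric a b c (rot_gen c) (rot_gen c)
    = mean_turning c x"
proof -
  note gen = Dt_rot_gen[OF Imm0D(1)[OF c]]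
  have "elastic_metric a b c h (rot_gen c) = a\<^sup>2 * integral unit_ivl (\<lambda>t. norm (Dt c t) * Im (x t))"
    by (subst elastic_metric_log_velocity[OF Imm0D(2)[OF c] h gen])
      (auto simp: mult.left_commute[of _ "a\<^sup>2"])
  moreover have "elastic_metric a b c (rot_gen c) (rot_gen c) = a\<^sup>2 * integral unit_ivl (\<lambda>t. norm (Dt c t))"
    by (subst elastic_metric_log_velocity[OF Imm0D(2)[OF c] gen gen])
      (auto simp: mult.commute[of _ "a\<^sup>2"])
  ultimately show ?thesis using a by (simp add: mean_turning_def)
qed

text \<open>The horizontal part of \<open>h\<close> has the logarithmic velocity \<open>x - \<i> * mean_turning c x\<close>, as the
  direction \<open>\<i> c\<close> of the orbit has the logarithmic velocity \<open>\<i>\<close>.\<close>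

lemma elastic_quotient_metric:
  assumes c: "c \<in> Imm0" and a: "a > 0"
    and h: "h \<in> Cinf" "\<And>t. t \<in> unit_ivl \<Longrightarrow> Dt h t = Dt c t * x t"
    and k: "k \<in> Cinf" "\<And>t. t \<in> unit_ivl \<Longrightarrow> Dt k t = Dt c t * y t"
  shows "quotient_metric (elastic_metric a b) c h k = integral unit_ivl (\<lambda>t. norm (Dt c t) *
    (a\<^sup>2 * ((Im (x t) - mean_turning c x) * (Im (y t) - mean_turning c y)) + b\<^sup>2 * (Re (x t) * Re (y t))))"
proof -
  have hor: "Dt (horizontal_part (elastic_metric a b) c h) t = Dt c t * (x t - \<i> * mean_turning c x)"
    if "t \<in> unit_ivl" "h \<in> Cinf" "\<And>t. t \<in> unit_ivl \<Longrightarrow> Dt h t = Dt c t * x t" for t h x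
  proof -
    have n: "elastic_metric a b c h (rot_gen c) / elastic_metric a b c (rot_gen c) (rot_gen c)
        = mean_turning c x"
      by (rule elastic_rotation_component[OF c a that(3)])
    show ?thesis
      unfolding Dt_horizontal_part[OF Imm0D(1)[OF c] that(2,1)] n
      using that by (simp add: scaleR_conv_of_real algebra_simps)
  qed
  show ?thesis
    unfolding quotient_metric_def
    by (subst elastic_metric_log_velocity[OF Imm0D(2)[OF c] hor[OF _ h] hor[OF _ k]]) auto
qed

text \<open>The direction \<open>\<i> q\<close> of the orbit has the constant logarithmic velocity \<open>\<i>\<close>, and the projection onto it
  is \<open>a / (2 b) * mean_turning c x + \<beta>\<close>. The horizontal part of \<open>w\<close> is thus the image under
  \<open>twist\<close> of \<open>x - \<i> * mean_turning c x\<close>, the logarithmic velocity of the horizontal part on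
  the side of \<open>c\<close>.\<close>

lemma L2_quotient_metric:
  assumes c: "c \<in> Imm0" and q: "continuous_on unit_ivl q" and ab: "a > 0" "b > 0"
    and qc: "\<And>t. t \<in> unit_ivl \<Longrightarrow> (norm (q t))\<^sup>2 = 4 * b\<^sup>2 * norm (Dt c t)"
    and x: "continuous_on unit_ivl x" "\<And>t. t \<in> unit_ivl \<Longrightarrow> w t = q t * (twist a b (x t) + \<i> * of_real \<beta>)"
    and y: "continuous_on unit_ivl y" "\<And>t. t \<in> unit_ivl \<Longrightarrow> z t = q t * (twist a b (y t) + \<i> * of_real \<beta>')"
  shows "quotient_metric L2_metric q w z = integral unit_ivl (\<lambda>t. norm (Dt c t) *
    (a\<^sup>2 * ((Im (x t) - mean_turning c x) * (Im (y t) - mean_turning c y)) + b\<^sup>2 * (Re (x t) * Re (y t))))"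
proof -
  have ct: "continuous_on unit_ivl (\<lambda>t. twist a b (x t))" if "continuous_on unit_ivl x" for x
    by (intro bounded_linear.continuous_on[OF bounded_linear_twist] that)
  have gen: "rot_gen q t = q t * \<i>" if "t \<in> unit_ivl" for t using that by (simp add: rot_gen_def)
  have n: "L2_metric q w (rot_gen q) / L2_metric q (rot_gen q) (rot_gen q)
      = a / (2 * b) * mean_turning c x + \<beta>"
    if x: "continuous_on unit_ivl x" "\<And>t. t \<in> unit_ivl \<Longrightarrow> w t = q t * (twist a b (x t) + \<i> * of_real \<beta>)"
    for x w \<beta>
  proof -
    let ?\<rho> = "\<lambda>t. norm (Dt c t)"
    have \<rho>: "continuous_on unit_ivl ?\<rho>" by (intro continuous_on_norm Imm0D c)
    have I: "?\<rho> integrable_on unit_ivl" "(\<lambda>t. ?\<rho> t * Im (x t)) integrable_on unit_ivl"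
      by (intro integrable_continuous_real continuous_intros \<rho> x)+
    have "L2_metric q w (rot_gen q) =
        integral unit_ivl (\<lambda>t. (norm (q t))\<^sup>2 * (a / (2 * b) * Im (x t) + \<beta>))"
      using L2_metric_log_velocity[OF q _ continuous_on_const x(2) gen] ct[OF x(1)]
      by (simp add: continuous_intros)
    also have "\<dots> = integral unit_ivl (\<lambda>t. (2 * a * b) *\<^sub>R (?\<rho> t * Im (x t)) + (4 * b\<^sup>2 * \<beta>) *\<^sub>R ?\<rho> t)"
      using ab by (intro integral_cong) (simp only: qc, simp add: power2_eq_square field_simps)
    also have "\<dots> = 2 * a * b * integral unit_ivl (\<lambda>t. ?\<rho> t * Im (x t)) + 4 * b\<^sup>2 * \<beta> * integral unit_ivl ?\<rho>"
      by (subst integral_add[OF integrable_cmul[OF I(2)] integrable_cmul[OF I(1)]]) simp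
    finally have 1: "L2_metric q w (rot_gen q) =
        2 * a * b * integral unit_ivl (\<lambda>t. ?\<rho> t * Im (x t)) + 4 * b\<^sup>2 * \<beta> * integral unit_ivl ?\<rho>" .
    have "L2_metric q (rot_gen q) (rot_gen q) = integral unit_ivl (\<lambda>t. (norm (q t))\<^sup>2)"
      using L2_metric_log_velocity[OF q continuous_on_const continuous_on_const gen gen] by simp
    also have "\<dots> = integral unit_ivl (\<lambda>t. (4 * b\<^sup>2) *\<^sub>R ?\<rho> t)"
      by (intro integral_cong) (simp add: qc)
    finally have 2: "L2_metric q (rot_gen q) (rot_gen q) = 4 * b\<^sup>2 * integral unit_ivl ?\<rho>" by simp
    show ?thesis
      unfolding 1 2 mean_turning_def using curve_length_pos[OF c] ab
      by (simp add: field_simps power2_eq_square)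
  qed
  have hor: "horizontal_part L2_metric q w t
      = q t * Complex (Re (x t) / 2) (a / (2 * b) * (Im (x t) - mean_turning c x))"
    if t: "t \<in> unit_ivl" and x: "continuous_on unit_ivl x"
      "\<And>t. t \<in> unit_ivl \<Longrightarrow> w t = q t * (twist a b (x t) + \<i> * of_real \<beta>)" for t x w \<beta>
  proof -
    have m: "L2_metric q w (rot_gen q) / L2_metric q (rot_gen q) (rot_gen q)
        = a / (2 * b) * mean_turning c x + \<beta>"
      by (rule n[OF x])
    have "horizontal_part L2_metric q w t = q t * (twist a b (x t) + \<i> * of_real \<beta>
        - \<i> * of_real (a / (2 * b) * mean_turning c x + \<beta>))"
      unfolding horizontal_part_def m using t by (simp add: gen x(2) scaleR_conv_of_real algebra_simps)
    also have "twist a b (x t) + \<i> * of_real \<beta> - \<i> * of_real (a / (2 * b) * mean_turning c x + \<beta>)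
        = Complex (Re (x t) / 2) (a / (2 * b) * (Im (x t) - mean_turning c x))"
      by (simp add: complex_eq_iff right_diff_distrib)
    finally show ?thesis .
  qed
  have cc: "continuous_on unit_ivl (\<lambda>t. Complex (Re (x t) / 2) (a / (2 * b) * (Im (x t) - mean_turning c x)))"
    if "continuous_on unit_ivl x" for x
    by (intro continuous_on_Complex continuous_intros that) auto
  have "quotient_metric L2_metric q w z = integral unit_ivl (\<lambda>t. (norm (q t))\<^sup>2 *
      (a / (2 * b) * (Im (x t) - mean_turning c x) * (a / (2 * b) * (Im (y t) - mean_turning c y))
       + Re (x t) / 2 * (Re (y t) / 2)))"
    unfolding quotient_metric_def
    using L2_metric_log_velocity[OF q cc[OF x(1)] cc[OF y(1)] hor[OF _ x] hor[OF _ y]] by simp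
  also have "\<dots> = integral unit_ivl (\<lambda>t. norm (Dt c t) *
    (a\<^sup>2 * ((Im (x t) - mean_turning c x) * (Im (y t) - mean_turning c y)) + b\<^sup>2 * (Re (x t) * Re (y t))))"
    using ab by (intro integral_cong) (simp only: qc, simp add: power2_eq_square field_simps)
  finally show ?thesis .
qed

section \<open>The induced isometry\<close>

text \<open>The functions \<open>\<eta> s\<close> are only known to lie in the right orbits. Comparing logarithms shows that its
  logarithm is the transformed logarithm of \<open>\<gamma>\<close> up to \<open>\<i> \<alpha>(s)\<close>, and \<open>\<beta>\<close> is the derivative of \<open>\<alpha>\<close> at
  \<open>0\<close>. For fixed \<open>s\<close> the number \<open>\<alpha>(s)\<close> is an unspecified witness; its differentiability in \<open>s\<close>
  comes from reading it off at \<open>t = 0\<close>.\<close>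

lemma transformed_velocity:
  assumes b: "b > 0"
    and \<Phi>: "\<And>c q. c \<in> Imm0 \<Longrightarrow> q \<in> F_values a b c \<Longrightarrow> \<Phi> (rot_orbit c) = rot_orbit q"
    and d: "quotient_differential Imm0 Cinf_star \<Phi> c h q w"
  obtains \<beta> :: real where
    "\<And>t. t \<in> unit_ivl \<Longrightarrow> w t = q t * (twist a b (Dt h t / Dt c t) + \<i> * of_real \<beta>)"
    "\<And>t. t \<in> unit_ivl \<Longrightarrow> (norm (q t))\<^sup>2 = 4 * b\<^sup>2 * norm (Dt c t)"
    "c \<in> Imm0" "q \<in> Cinf_star" "h \<in> Cinf"
proof -
  obtain \<gamma> \<eta> where \<gamma>: "smooth_curve Imm0 \<gamma>" "\<gamma> 0 = c" "has_Cinf_derivative \<gamma> h 0"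
    and \<eta>: "smooth_curve Cinf_star \<eta>" "\<eta> 0 = q" "has_Cinf_derivative \<eta> w 0"
    and eq: "\<And>s. \<Phi> (rot_orbit (\<gamma> s)) = rot_orbit (\<eta> s)"
    using d unfolding quotient_differential_def by blast
  have Imm: "\<gamma> s \<in> Imm0" and star: "\<eta> s \<in> Cinf_star" for s
    using \<gamma>(1) \<eta>(1) by (simp_all add: smooth_curve_def)
  have C: "\<gamma> s \<in> Cinf" "\<eta> s \<in> Cinf" for s using Imm star Imm0_Cinf Cinf_star_Cinf by blast+
  have D: "smooth_strip (\<lambda>s. Dt (\<gamma> s))"
    by (rule smooth_strip_partials(3)[OF smooth_curve_imp_strip[OF \<gamma>(1) Imm0_Cinf]])
  obtain l where l: "strip_continuous l" "\<And>s t. t \<in> unit_ivl \<Longrightarrow> Dt (\<gamma> s) t = exp (l s t)"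
    by (rule strip_log_exists[OF smooth_strip_continuous[OF D]]) (use Imm in \<open>auto simp: Imm0_def\<close>)
  obtain m where m: "strip_continuous m" "\<And>s t. t \<in> unit_ivl \<Longrightarrow> \<eta> s t = exp (m s t)"
    by (rule strip_log_exists[OF smooth_strip_continuous[OF smooth_curve_imp_strip[OF \<eta>(1) Cinf_star_Cinf]]])
      (use star in \<open>auto simp: Cinf_star_def\<close>)
  note lc = strip_continuous_slice[OF l(1)] and mc = strip_continuous_slice[OF m(1)]
  have shift: "\<exists>\<alpha>::real. \<forall>t\<in>unit_ivl. m s t = log_transform a b (l s t) + \<i> * \<alpha>" for s
  proof -
    let ?q = "\<lambda>t\<in>unit_ivl. exp (log_transform a b (l s t))"
    have "?q \<in> F_values a b (\<gamma> s)"
      unfolding F_values_iff_logarithm[OF b Imm] using lc l(2) by blast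
    then have "rot_orbit (\<eta> s) = rot_orbit ?q" using eq \<Phi>[OF Imm] by metis
    then obtain \<psi> where \<psi>: "\<eta> s = rot \<psi> ?q"
      using C(2)[of s] by (elim rot_orbit_eqE) (auto simp: Cinf_def)
    have "exp (m s t) = exp (\<i> * of_real \<psi>) * exp (log_transform a b (l s t))" if "t \<in> unit_ivl" for t
      using fun_cong[OF \<psi>, of t] m(2)[OF that, of s] that by (simp add: rot_def)
    moreover have "continuous_on unit_ivl (\<lambda>t. log_transform a b (l s t))"
      unfolding log_transform_def
      by (intro continuous_intros bounded_linear.continuous_on[OF bounded_linear_twist] lc)
    ultimately show ?thesis using logarithms_of_rotated[OF _ mc] by metis
  qed
  have m_eq: "m s t = log_transform a b (l s t) + \<i> * Im (m s 0 - log_transform a b (l s 0))"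
    if t: "t \<in> unit_ivl" for s t
  proof -
    obtain \<alpha> :: real where \<alpha>: "\<And>t. t \<in> unit_ivl \<Longrightarrow> m s t = log_transform a b (l s t) + \<i> * \<alpha>"
      using shift by blast
    have "Im (m s 0 - log_transform a b (l s 0)) = \<alpha>" using \<alpha>[of 0] by simp
    then show ?thesis using \<alpha>[OF t] by simp
  qed
  have cont: "continuous (at s) (\<lambda>u. f u t)" if "strip_continuous f" "t \<in> unit_ivl" for f s t
  proof -
    have "continuous_on UNIV (\<lambda>u. f u t)"
      by (rule strip_continuous_comp[OF that(1)]) (use that in \<open>auto intro!: continuous_intros\<close>)
    then show ?thesis by (simp add: continuous_on_eq_continuous_within)
  qed
  have dl: "((\<lambda>u. l u t) has_vector_derivative Dt h t / Dt c t) (at 0)" if t: "t \<in> unit_ivl" for t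
    using vderiv_log[OF cont[OF l(1) t] l(2)[OF t] UNIV_I Cinf_derivative_vderiv[OF C(1) \<gamma>(3) t, of 1, simplified]]
    by (simp add: \<gamma>(2))
  have dm: "((\<lambda>u. m u t) has_vector_derivative w t / q t) (at 0)" if t: "t \<in> unit_ivl" for t
    using vderiv_log[OF cont[OF m(1) t] m(2)[OF t] UNIV_I Cinf_derivative_vderiv[OF C(2) \<eta>(3) t, of 0, simplified]]
    by (simp add: \<eta>(2))
  have dL: "((\<lambda>u. log_transform a b (l u t)) has_vector_derivative twist a b (Dt h t / Dt c t)) (at 0)"
    if t: "t \<in> unit_ivl" for t
    unfolding log_transform_def
    using has_vector_derivative_add[OF has_vector_derivative_const
        bounded_linear.has_vector_derivative[OF bounded_linear_twist dl[OF t]]] by simp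
  define \<beta> where "\<beta> = Im (w 0 / q 0 - twist a b (Dt h 0 / Dt c 0))"
  have dshift: "((\<lambda>u. \<i> * of_real (Im (m u 0 - log_transform a b (l u 0)))) has_vector_derivative \<i> * of_real \<beta>) (at 0)"
    unfolding \<beta>_def
    by (intro has_vector_derivative_mult_right
        bounded_linear.has_vector_derivative[OF bounded_linear_of_real]
        bounded_linear.has_vector_derivative[OF bounded_linear_Im] has_vector_derivative_diff dm dL) auto
  show ?thesis
  proof (rule that)
    show "c \<in> Imm0" "q \<in> Cinf_star" using Imm[of 0] star[of 0] \<gamma>(2) \<eta>(2) by auto
    show "h \<in> Cinf" using \<gamma>(3) by (simp add: has_Cinf_derivative_def)
    fix t :: real assume t: "t \<in> unit_ivl"
    have "((\<lambda>u. m u t) has_vector_derivative twist a b (Dt h t / Dt c t) + \<i> * of_real \<beta>) (at 0)"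
      using has_vector_derivative_add[OF dL[OF t] dshift] by (simp only: m_eq[OF t, symmetric])
    then have "w t / q t = twist a b (Dt h t / Dt c t) + \<i> * of_real \<beta>"
      by (rule vector_derivative_unique_at[OF dm[OF t]])
    moreover have "q t \<noteq> 0" using star[of 0] t by (simp add: \<eta>(2) Cinf_star_def)
    ultimately show "w t = q t * (twist a b (Dt h t / Dt c t) + \<i> * of_real \<beta>)"
      by (simp add: field_simps)
    have "(norm (q t))\<^sup>2 = (exp (ln (2 * b) + Re (l 0 t) / 2))\<^sup>2"
      using m(2)[OF t, of 0] m_eq[OF t, of 0] by (simp add: \<eta>(2) log_transform_def)
    also have "\<dots> = 4 * b\<^sup>2 * exp (Re (l 0 t))"
      using b by (simp add: exp_add power_mult_distrib exp_double[symmetric])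
    finally show "(norm (q t))\<^sup>2 = 4 * b\<^sup>2 * norm (Dt c t)"
      using l(2)[OF t, of 0] by (simp add: \<gamma>(2))
  qed
qed

text \<open>The union makes the definition independent of the choice of a representative and of an angle. By
  \<open>elastic_map_orbit\<close> it is the union of a single orbit.\<close>

definition elastic_map :: "real \<Rightarrow> real \<Rightarrow> (real \<Rightarrow> complex) set \<Rightarrow> (real \<Rightarrow> complex) set" where
  "elastic_map a b X = (\<Union>c\<in>X \<inter> Imm0. \<Union>q\<in>F_values a b c. rot_orbit q)"

lemma elastic_map_orbit:
  assumes b: "b > 0" and c: "c \<in> Imm0" and q: "q \<in> F_values a b c"
  shows "elastic_map a b (rot_orbit c) = rot_orbit q"
proof -
  have "c \<in> rot_orbit c" using c by (intro rot_orbit_refl) (auto simp: Imm0_def Cinf_def)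
  moreover have "rot_orbit q' = rot_orbit q"
    if "c' \<in> rot_orbit c \<inter> Imm0" "q' \<in> F_values a b c'" for c' q'
    using F_values_same_orbit[OF b c _ _ q that(2)] that(1) by (auto simp: rot_orbit_def)
  ultimately show ?thesis unfolding elastic_map_def using c q by blast
qed

theorem theorem3p2:
  fixes a b :: real
  assumes "a > 0" and "b > 0"
  shows "\<exists>\<Phi>. (\<forall>c\<in>Imm0. F_values a b c \<noteq> {} \<and>
                  (\<forall>q\<in>F_values a b c. \<Phi> (rot_orbit c) = rot_orbit q)) \<and>
             quotient_isometry Imm0 (elastic_metric a b) Cinf_star L2_metric \<Phi>"
proof (intro exI conjI ballI)
  note ab = assms
  let ?\<Phi> = "elastic_map a b"
  have \<Phi>: "?\<Phi> (rot_orbit c) = rot_orbit q" if "c \<in> Imm0" "q \<in> F_values a b c" for c q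
    by (rule elastic_map_orbit[OF ab(2) that])
  then show "?\<Phi> (rot_orbit c) = rot_orbit q" if "c \<in> Imm0" "q \<in> F_values a b c" for c q
    using that by blast
  have F_ex: "\<exists>q\<in>F_values a b c. q \<in> Cinf_star" if c: "c \<in> Imm0" for c
  proof -
    obtain \<eta> where "smooth_curve Cinf_star \<eta>" "\<And>s. \<eta> s \<in> F_values a b c"
      using transform_smooth_curve[OF ab(2) smooth_curve_const[OF c Imm0_Cinf]] by blast
    then show ?thesis by (auto simp: smooth_curve_def intro!: bexI[of _ "\<eta> 0"])
  qed
  then show "F_values a b c \<noteq> {}" if "c \<in> Imm0" for c using that by blast
  have F_surj: "\<exists>c\<in>Imm0. q \<in> F_values a b c" if q: "q \<in> Cinf_star" for q
  proof -
    obtain \<gamma> where "smooth_curve Imm0 \<gamma>" "\<And>s. q \<in> F_values a b (\<gamma> s)"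
      using untransform_smooth_curve[OF ab smooth_curve_const[OF q Cinf_star_Cinf]] by blast
    then show ?thesis by (auto simp: smooth_curve_def intro!: bexI[of _ "\<gamma> 0"])
  qed
  have inj: "inj_on ?\<Phi> (rot_quotient Imm0)"
  proof (rule inj_onI)
    fix X Y assume "X \<in> rot_quotient Imm0" "Y \<in> rot_quotient Imm0" and eq: "?\<Phi> X = ?\<Phi> Y"
    then obtain c c' where c: "c \<in> Imm0" "c' \<in> Imm0" "X = rot_orbit c" "Y = rot_orbit c'"
      by (auto simp: rot_quotient_def)
    obtain q q' where q: "q \<in> F_values a b c" "q' \<in> F_values a b c'"
      using F_ex[OF c(1)] F_ex[OF c(2)] by blast
    show "X = Y"
      using F_values_orbit_injective[OF ab c(2,1) q(2,1)] eq
      by (simp add: c \<Phi>[OF c(1) q(1)] \<Phi>[OF c(2) q(2)])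
  qed
  have bij: "bij_betw ?\<Phi> (rot_quotient Imm0) (rot_quotient Cinf_star)"
  proof (rule bij_betw_imageI[OF inj])
    have "?\<Phi> (rot_orbit c) \<in> rot_quotient Cinf_star" if "c \<in> Imm0" for c
      using F_ex[OF that] \<Phi>[OF that] by (auto simp: rot_quotient_def)
    moreover have "rot_orbit q \<in> ?\<Phi> ` rot_quotient Imm0" if "q \<in> Cinf_star" for q
      using F_surj[OF that] \<Phi> unfolding rot_quotient_def by (metis image_eqI)
    ultimately show "?\<Phi> ` rot_quotient Imm0 = rot_quotient Cinf_star"
      by (auto simp: rot_quotient_def)
  qed
  have smooth: "smooth_quotient_map Imm0 Cinf_star ?\<Phi>"
    unfolding smooth_quotient_map_def smooth_quotient_curve_def
  proof (intro allI impI, elim exE conjE)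
    fix \<Gamma> \<gamma> assume \<gamma>: "smooth_curve Imm0 \<gamma>" and \<Gamma>: "\<Gamma> = (\<lambda>s. rot_orbit (\<gamma> s))"
    obtain \<eta> where \<eta>: "smooth_curve Cinf_star \<eta>" "\<And>s. \<eta> s \<in> F_values a b (\<gamma> s)"
      using transform_smooth_curve[OF ab(2) \<gamma>] by blast
    have "?\<Phi> \<circ> \<Gamma> = (\<lambda>s. rot_orbit (\<eta> s))"
      using \<Phi>[OF _ \<eta>(2)] \<gamma> by (auto simp: \<Gamma> smooth_curve_def)
    then show "\<exists>\<eta>. smooth_curve Cinf_star \<eta> \<and> ?\<Phi> \<circ> \<Gamma> = (\<lambda>s. rot_orbit (\<eta> s))"
      using \<eta>(1) by blast
  qed
  have smooth_inv: "smooth_quotient_map Cinf_star Imm0 (inv_into (rot_quotient Imm0) ?\<Phi>)"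
    unfolding smooth_quotient_map_def smooth_quotient_curve_def
  proof (intro allI impI, elim exE conjE)
    fix \<Gamma> \<eta> assume \<eta>: "smooth_curve Cinf_star \<eta>" and \<Gamma>: "\<Gamma> = (\<lambda>s. rot_orbit (\<eta> s))"
    obtain \<gamma> where \<gamma>: "smooth_curve Imm0 \<gamma>" "\<And>s. \<eta> s \<in> F_values a b (\<gamma> s)"
      using untransform_smooth_curve[OF ab \<eta>] by blast
    have "inv_into (rot_quotient Imm0) ?\<Phi> (rot_orbit (\<eta> s)) = rot_orbit (\<gamma> s)" for s
    proof -
      have "\<gamma> s \<in> Imm0" using \<gamma>(1) by (simp add: smooth_curve_def)
      then show ?thesis
        using inv_into_f_f[OF inj, of "rot_orbit (\<gamma> s)"] \<Phi>[OF _ \<gamma>(2)] by (simp add: rot_quotient_def)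
    qed
    then show "\<exists>\<gamma>. smooth_curve Imm0 \<gamma> \<and>
        inv_into (rot_quotient Imm0) ?\<Phi> \<circ> \<Gamma> = (\<lambda>s. rot_orbit (\<gamma> s))"
      using \<gamma>(1) by (intro exI[of _ \<gamma>]) (auto simp: \<Gamma>)
  qed
  have "quotient_metric L2_metric q w z = quotient_metric (elastic_metric a b) c h k"
    if d: "quotient_differential Imm0 Cinf_star ?\<Phi> c h q w"
      "quotient_differential Imm0 Cinf_star ?\<Phi> c k q z" for c h k q w z
  proof -
    obtain \<beta> :: real where w: "\<And>t. t \<in> unit_ivl \<Longrightarrow> w t = q t * (twist a b (Dt h t / Dt c t) + \<i> * of_real \<beta>)"
      and qc: "\<And>t. t \<in> unit_ivl \<Longrightarrow> (norm (q t))\<^sup>2 = 4 * b\<^sup>2 * norm (Dt c t)"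
      and c: "c \<in> Imm0" and q: "q \<in> Cinf_star" and h: "h \<in> Cinf"
      using transformed_velocity[OF ab(2) \<Phi> d(1)] by blast
    obtain \<beta>' :: real where z: "\<And>t. t \<in> unit_ivl \<Longrightarrow> z t = q t * (twist a b (Dt k t / Dt c t) + \<i> * of_real \<beta>')"
      and k: "k \<in> Cinf"
      using transformed_velocity[OF ab(2) \<Phi> d(2)] by blast
    have cont: "continuous_on unit_ivl (\<lambda>t. Dt h t / Dt c t)" if "h \<in> Cinf" for h
      by (intro continuous_on_divide Cinf_Dt_continuous that Imm0D(3)[OF c]) (use Imm0D(2)[OF c] in auto)
    have split: "Dt h t = Dt c t * (Dt h t / Dt c t)" if "t \<in> unit_ivl" for t h
      using Imm0D(2)[OF c that] by simp
    have qcont: "continuous_on unit_ivl q"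
      using Cinf_Dt_pow_continuous[of q 0] q Cinf_star_Cinf by auto
    show ?thesis
      by (rule trans[OF L2_quotient_metric[OF c qcont ab qc cont[OF h] w cont[OF k] z]
            elastic_quotient_metric[OF c ab(1) h split k split, symmetric]])
  qed
  then show "quotient_isometry Imm0 (elastic_metric a b) Cinf_star L2_metric ?\<Phi>"
    unfolding quotient_isometry_def using bij smooth smooth_inv by blast
qed

end
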